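(* Let $\kappa$ be a regular uncountable cardinal such that $\square(\kappa)$ holds and $\kappa^{<\kappa}=\kappa$. Then for every stationary $S\in J_\omega[\kappa]$, $\boxtimes^-(S)$ holds.
   Context: For a set $x$ of ordinals, $\mathrm{acc}(x)=\{\alpha\in x\mid\sup(x\cap\alpha)=\alpha>0\}$ and $\mathrm{nacc}(x)=x\setminus\mathrm{acc}(x)$. A $C$-sequence over $\kappa$ is $\langle C_\alpha\mid\alpha<\kappa\rangle$ where each $C_\alpha$ is a closed subset of $\alpha$ with $\sup(C_\alpha)=\sup(\alpha)$; it is coherent if $C_{\bar\alpha}=C_\alpha\cap\bar\alpha$ for all $\alpha<\kappa$ and $\bar\alpha\in\mathrm{acc}(C_\alpha)$. $\square(\kappa)$ asserts the existence of a coherent $C$-sequence over $\kappa$ such that there is no club $D\subseteq\kappa$ with $D\cap\alpha=C_\alpha$ for all $\alpha\in\mathrm{acc}(D)$. For stationary $S\subseteq\kappa$, $\boxtimes^-(S)$ asserts the existence of a coherent $C$-sequence $\langle C_\alpha\mid\alpha<\kappa\rangle$ such that for every cofinal $A\subseteq\kappa$ there is a nonzero $\alpha\in S$ with $\sup(\mathrm{nacc}(C_\alpha)\cap A)=\alpha$. $J_\omega[\kappa]$ is the collection of all $S\subseteq\kappa$ for which there exist a club $C\subseteq\kappa$ and functions $f_i:\kappa\to[\kappa]^{<\omega}$ ($i<\kappa$) such that for every $\alpha\in S\cap C$, every regressive $f:\alpha\to\alpha$ and every cofinal $B\subseteq\alpha$, there is $i<\alpha$ with $\sup\{\beta\in B\mid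 f(\beta)\in f_i(\beta)\}=\alpha$. *)

theory Defs
  imports Main
begin

text \<open>Ordinals below the cardinal kappa are modelled as the elements of Field r,
  where r is a cardinal order (initial well-order) representing kappa.\<close>

definition olt :: "'a rel \<Rightarrow> 'a \<Rightarrow> 'a \<Rightarrow> bool" where
  "olt r a b \<longleftrightarrow> (a, b) \<in> r \<and> a \<noteq> b"

definition onz :: "'a rel \<Rightarrow> 'a \<Rightarrow> bool" where
  "onz r a \<longleftrightarrow> (\<exists>b. olt r b a)"

definition is_sup :: "'a rel \<Rightarrow> 'a set \<Rightarrow> 'a \<Rightarrow> bool" where
  "is_sup r X s \<longleftrightarrow> s \<in> Field r \<and> (\<forall>x\<in>X. (x, s) \<in> r) \<and>
     (\<forall>t\<in>Field r. (\<forall>x\<in>X. (x, t) \<in> r) \<longrightarrow> (s, t) \<in> r)"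

definition acc :: "'a rel \<Rightarrow> 'a set \<Rightarrow> 'a set" where
  "acc r x = {\<alpha> \<in> x. onz r \<alpha> \<and> is_sup r (x \<inter> underS r \<alpha>) \<alpha>}"

definition nacc :: "'a rel \<Rightarrow> 'a set \<Rightarrow> 'a set" where
  "nacc r x = x - acc r x"

definition closed_in_ord :: "'a rel \<Rightarrow> 'a set \<Rightarrow> 'a \<Rightarrow> bool" where
  "closed_in_ord r C \<alpha> \<longleftrightarrow> C \<subseteq> underS r \<alpha> \<and>
     (\<forall>\<gamma>\<in>underS r \<alpha>. onz r \<gamma> \<and> is_sup r (C \<inter> underS r \<gamma>) \<gamma> \<longrightarrow> \<gamma> \<in> C)"

definition C_sequence :: "'a rel \<Rightarrow> ('a \<Rightarrow> 'a set) \<Rightarrow> bool" where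
  "C_sequence r C \<longleftrightarrow> (\<forall>\<alpha>\<in>Field r. closed_in_ord r (C \<alpha>) \<alpha> \<and>
     (\<exists>s. is_sup r (C \<alpha>) s \<and> is_sup r (underS r \<alpha>) s))"

definition coherent :: "'a rel \<Rightarrow> ('a \<Rightarrow> 'a set) \<Rightarrow> bool" where
  "coherent r C \<longleftrightarrow> (\<forall>\<alpha>\<in>Field r. \<forall>\<beta>\<in>acc r (C \<alpha>). C \<beta> = C \<alpha> \<inter> underS r \<beta>)"

definition unbounded :: "'a rel \<Rightarrow> 'a set \<Rightarrow> bool" where
  "unbounded r A \<longleftrightarrow> A \<subseteq> Field r \<and> (\<forall>\<beta>\<in>Field r. \<exists>\<gamma>\<in>A. olt r \<beta> \<gamma>)"

definition club :: "'a rel \<Rightarrow> 'a set \<Rightarrow> bool" where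
  "club r D \<longleftrightarrow> unbounded r D \<and>
     (\<forall>\<alpha>\<in>Field r. onz r \<alpha> \<and> is_sup r (D \<inter> underS r \<alpha>) \<alpha> \<longrightarrow> \<alpha> \<in> D)"

definition stationary :: "'a rel \<Rightarrow> 'a set \<Rightarrow> bool" where
  "stationary r S \<longleftrightarrow> S \<subseteq> Field r \<and> (\<forall>D. club r D \<longrightarrow> S \<inter> D \<noteq> {})"

definition square :: "'a rel \<Rightarrow> bool" where
  "square r \<longleftrightarrow> (\<exists>C. C_sequence r C \<and> coherent r C \<and>
     \<not> (\<exists>D. club r D \<and> (\<forall>\<alpha>\<in>acc r D. D \<inter> underS r \<alpha> = C \<alpha>)))"

definition boxtimes_minus :: "'a rel \<Rightarrow> 'a set \<Rightarrow> bool" where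
  "boxtimes_minus r S \<longleftrightarrow> (\<exists>C. C_sequence r C \<and> coherent r C \<and>
     (\<forall>A. unbounded r A \<longrightarrow>
        (\<exists>\<alpha>\<in>S. onz r \<alpha> \<and> is_sup r (nacc r (C \<alpha>) \<inter> A) \<alpha>)))"

definition J_omega :: "'a rel \<Rightarrow> 'a set set" where
  "J_omega r = {S. S \<subseteq> Field r \<and>
     (\<exists>Cl F. club r Cl \<and>
        (\<forall>i\<in>Field r. \<forall>\<beta>\<in>Field r. finite (F i \<beta>) \<and> F i \<beta> \<subseteq> Field r) \<and>
        (\<forall>\<alpha>\<in>S \<inter> Cl. \<forall>f B.
           (\<forall>\<beta>\<in>underS r \<alpha>. f \<beta> \<in> underS r \<alpha> \<and> (onz r \<beta> \<longrightarrow> olt r (f \<beta>) \<beta>)) \<and>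
           B \<subseteq> underS r \<alpha> \<and> is_sup r B \<alpha> \<longrightarrow>
           (\<exists>i\<in>underS r \<alpha>. is_sup r {\<beta>\<in>B. f \<beta> \<in> F i \<beta>} \<alpha>)))}"

definition uncountable_set :: "'a set \<Rightarrow> bool" where
  "uncountable_set A \<longleftrightarrow> \<not> (\<exists>f :: 'a \<Rightarrow> nat. inj_on f A)"

text \<open>kappa^{<kappa} = kappa: kappa^lambda <= kappa for every lambda < kappa.\<close>
definition small_exp :: "'a rel \<Rightarrow> bool" where
  "small_exp r \<longleftrightarrow> (\<forall>a\<in>Field r.
     (BNF_Cardinal_Order_Relation.card_of (Func (underS r a) (Field r)), r) \<in> ordLeq)"

end

theory Submission
  imports Defs "HOL-Library.Countable_Set"
begin

text \<open>
  For a club \<open>D\<close>, replacing \<open>C\<^sub>\<alpha>\<close> by the set of all \<open>sup (D \<inter> \<eta>)\<close> with \<open>\<eta> \<in> C\<^sub>\<alpha>\<close> preserves coherence.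
  If for every \<open>D\<close> the resulting ladder fails to guess some club on \<open>S\<close>, iterate along a \<open>\<theta> < \<kappa>\<close>
  with uncountably many predecessors to get decreasing clubs \<open>D\<^sub>i\<close>. For \<open>\<eta> \<in> C\<^sub>\<alpha>\<close> the values
  \<open>sup (D\<^sub>i \<inter> \<eta>)\<close> decrease, so two of them agree, and this forces a final segment of \<open>D\<^sub>\<theta> \<inter> \<alpha>\<close>
  into \<open>acc (C\<^sub>\<alpha>)\<close> for stationarily many \<open>\<alpha>\<close>; pressing down yields a thread through the
  \<open>\<box>(\<kappa>)\<close>-sequence. So some coherent ladder guesses clubs on \<open>S\<close>. When no such \<open>\<theta>\<close> exists, a
  diagonalisation shows that no stationary set belongs to \<open>J\<^sub>\<omega>[\<kappa>]\<close>.

  To pass from clubs to arbitrary cofinal sets, use \<open>\<kappa>\<^sup><\<^sup>\<kappa> = \<kappa>\<close> to read an ordinal as a short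
  sequence of ordinals. For \<open>i < \<kappa>\<close>, insert into every gap \<open>(a, b)\<close> of \<open>C\<^sub>\<alpha>\<close> the \<open>i\<close>-th entries of
  the sequences of length \<open>a\<close> coded in the finite set \<open>f\<^sub>i(b)\<close>. If for each \<open>i\<close> this fails on a cofinal
  set \<open>A\<^sub>i\<close>, the map sending \<open>b\<close> to the code of a choice of points of \<open>A\<^sub>i\<close> above \<open>a\<close>, for all \<open>i < a\<close>
  at once, is regressive on the guessed points, so some \<open>i < \<alpha>\<close> captures it cofinally often below
  \<open>\<alpha>\<close>, contradicting the choice of \<open>A\<^sub>i\<close>.
\<close>

unbundle cardinal_syntax

section \<open>Strict order, bounds from regularity, and limit points\<close>

locale regular_uncountable =
  fixes r :: "'a rel"
  assumes card: "Card_order r" and reg: "regularCard r" and unc: "uncountable_set (Field r)"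
begin

abbreviation lt (infix "\<prec>" 50) where "a \<prec> b \<equiv> olt r a b"

abbreviation K where "K \<equiv> Field r"

text \<open>The limit point condition shared by \<open>acc\<close>, \<open>club\<close> and
  closedness (see \<open>is_sup_Int_iff\<close>), phrased with the strict order only. Membership of
  \<delta> in \<open>X\<close> is left out so that closedness can be stated with it;
  \<open>onz\<close> excludes 0, where the second clause is vacuous.\<close>

definition lpt :: "'a set \<Rightarrow> 'a \<Rightarrow> bool" where
  "lpt X \<delta> \<longleftrightarrow> onz r \<delta> \<and> (\<forall>e. e \<prec> \<delta> \<longrightarrow> (\<exists>x\<in>X. e \<prec> x \<and> x \<prec> \<delta>))"

lemma well_order: "Well_order r"
  using card card_order_on_well_order_on by blast

lemma lt_Field: "a \<prec> b \<Longrightarrow> a \<in> K \<and> b \<in> K"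
  by (auto simp: olt_def Field_def)

lemma lt_irrefl [simp]: "\<not> a \<prec> a"
  by (simp add: olt_def)

lemma lt_trans: "a \<prec> b \<Longrightarrow> b \<prec> c \<Longrightarrow> a \<prec> c"
  using well_order unfolding olt_def well_order_on_def linear_order_on_def partial_order_on_def
    preorder_on_def by (metis antisymD transD)

lemma lt_linear: "a \<in> K \<Longrightarrow> b \<in> K \<Longrightarrow> a \<prec> b \<or> a = b \<or> b \<prec> a"
  using well_order unfolding olt_def well_order_on_def linear_order_on_def total_on_def by blast

lemma lt_le_trans: "a \<prec> b \<Longrightarrow> c \<in> K \<Longrightarrow> \<not> c \<prec> b \<Longrightarrow> a \<prec> c"
  by (metis lt_Field lt_linear lt_trans)

lemma le_lt_trans: "a \<in> K \<Longrightarrow> \<not> b \<prec> a \<Longrightarrow> b \<prec> c \<Longrightarrow> a \<prec> c"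
  by (metis lt_Field lt_linear lt_trans)

lemma le_iff: "(a, b) \<in> r \<longleftrightarrow> a \<in> K \<and> b \<in> K \<and> \<not> b \<prec> a"
proof -
  have "refl_on K r" "antisym r"
    using well_order by (auto simp: well_order_on_def linear_order_on_def partial_order_on_def
        preorder_on_def)
  then show ?thesis
    using lt_linear[of a b] by (auto simp: olt_def refl_on_def Field_def dest: antisymD)
qed

lemma mem_underS [simp]: "b \<in> underS r a \<longleftrightarrow> b \<prec> a"
  by (auto simp: underS_def olt_def)

lemma wf_lt: "wf {(a, b). a \<prec> b}"
proof -
  have "wf (r - Id)"
    using well_order by (simp add: well_order_on_def)
  moreover have "{(a, b). a \<prec> b} = r - Id"
    by (auto simp: olt_def)
  ultimately show ?thesis by simp
qed

lemma ex_least: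
  assumes "X \<noteq> {}" "X \<subseteq> K"
  obtains m where "m \<in> X" "\<And>x. x \<in> X \<Longrightarrow> \<not> x \<prec> m"
  using assms wf_lt unfolding wf_eq_minimal by (metis (mono_tags, lifting) all_not_in_conv
      case_prodI mem_Collect_eq)

text \<open>Regularity gives every cofinal subset of \<open>K\<close> the full cardinality, so a
  smaller set has a weak bound; an infinite cardinal has no last element, so the bound can be made
  strict.\<close>

lemma ex_upper_bound:
  assumes "X \<subseteq> K" "|X| <o r"
  obtains b where "b \<in> K" "\<And>x. x \<in> X \<Longrightarrow> x \<prec> b"
proof -
  have "\<not> cofinal X r"
    using assms reg unfolding regularCard_def
    by (metis not_ordLess_ordIso)
  then obtain b0 where b0: "b0 \<in> K" "\<And>x. x \<in> X \<Longrightarrow> \<not> b0 \<prec> x"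
    by (auto simp: cofinal_def olt_def)
  have "infinite K"
    using unc finite_imp_inj_to_nat_seg unfolding uncountable_set_def by metis
  then obtain b where "b \<in> K" "b0 \<prec> b"
    using card infinite_Card_order_limit b0(1) by (metis olt_def)
  with b0 have "\<And>x. x \<in> X \<Longrightarrow> x \<prec> b"
    using assms(1) le_lt_trans by blast
  with \<open>b \<in> K\<close> that show thesis by blast
qed

lemma ex_bound_underS:
  assumes "a \<in> K" "\<And>x. x \<prec> a \<Longrightarrow> f x \<in> K"
  obtains b where "b \<in> K" "\<And>x. x \<prec> a \<Longrightarrow> f x \<prec> b"
proof (rule ex_upper_bound)
  show "f ` underS r a \<subseteq> K" using assms by auto
  show "|f ` underS r a| <o r"
    using card_of_underS[OF card assms(1)] card_of_image ordLeq_ordLess_trans by blast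
qed (use that in auto)

lemma countable_ordLess:
  assumes "countable X"
  shows "|X| <o r"
proof -
  have "\<not> |K| \<le>o |X|"
  proof
    assume "|K| \<le>o |X|"
    then obtain f where "inj_on f K" "f ` K \<subseteq> X"
      using card_of_ordLeq[of K X] by blast
    moreover obtain g :: "'b \<Rightarrow> nat" where "inj_on g X"
      using assms by (auto simp: countable_def)
    ultimately have "inj_on (g \<circ> f) K"
      by (metis comp_inj_on inj_on_subset)
    then show False
      using unc unfolding uncountable_set_def by blast
  qed
  then have "|X| <o |K|"
    using not_ordLeq_iff_ordLess[OF card_of_Well_order card_of_Well_order] by blast
  then show ?thesis
    using card_of_Field_ordIso[OF card] ordLess_ordIso_trans by blast
qed

lemma ex_greater:
  assumes "a \<in> K" "b \<in> K"
  obtains c where "a \<prec> c" "b \<prec> c"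
proof -
  have "|{a, b}| <o r" by (simp add: countable_ordLess)
  with assms obtain c where "\<And>x. x \<in> {a, b} \<Longrightarrow> x \<prec> c"
    using ex_upper_bound[of "{a, b}"] by blast
  then show thesis using that by blast
qed

lemma lpt_onz: "lpt X \<delta> \<Longrightarrow> onz r \<delta>"
  by (simp add: lpt_def)

lemma lpt_Field: "lpt X \<delta> \<Longrightarrow> \<delta> \<in> K"
  by (auto simp: lpt_def onz_def dest: lt_Field)

lemma lptE:
  assumes "lpt X \<delta>" "e \<prec> \<delta>"
  obtains x where "x \<in> X" "e \<prec> x" "x \<prec> \<delta>"
  using assms by (auto simp: lpt_def)

lemma lptE2:
  assumes "lpt X \<delta>" "d \<prec> \<delta>" "e \<prec> \<delta>"
  obtains x where "x \<in> X" "d \<prec> x" "e \<prec> x" "x \<prec> \<delta>"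
proof -
  obtain x where x: "x \<in> X" "d \<prec> x" "x \<prec> \<delta>"
    using assms by (auto elim: lptE)
  obtain y where y: "y \<in> X" "e \<prec> y" "y \<prec> \<delta>"
    using assms by (auto elim: lptE)
  show thesis
  proof (cases "x \<prec> y")
    case True
    with that x y lt_trans show thesis by blast
  next
    case False
    then have "e \<prec> x" using x y lt_le_trans lt_Field by blast
    with that x show thesis by blast
  qed
qed

lemma lpt_mono: "lpt X \<delta> \<Longrightarrow> (\<And>x. x \<in> X \<Longrightarrow> x \<prec> \<delta> \<Longrightarrow> x \<in> Y) \<Longrightarrow> lpt Y \<delta>"
  by (meson lpt_def)

lemma lpt_K: "lpt X \<delta> \<Longrightarrow> lpt K \<delta>"
  using lpt_mono lt_Field by blast

lemma lpt_lpt: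
  assumes "lpt {\<delta>. lpt X \<delta>} \<alpha>"
  shows "lpt X \<alpha>"
  unfolding lpt_def
proof (intro conjI allI impI)
  fix e assume "e \<prec> \<alpha>"
  with assms obtain d where "lpt X d" "e \<prec> d" "d \<prec> \<alpha>" by (auto elim: lptE)
  then show "\<exists>x\<in>X. e \<prec> x \<and> x \<prec> \<alpha>" by (meson lptE lt_trans)
qed (use assms lpt_onz in auto)

lemma is_sup_iff:
  assumes "X \<subseteq> underS r \<alpha>" "onz r \<alpha>"
  shows "is_sup r X \<alpha> \<longleftrightarrow> lpt X \<alpha>"
proof
  assume sup: "is_sup r X \<alpha>"
  show "lpt X \<alpha>"
    unfolding lpt_def
  proof (intro conjI allI impI)
    fix e assume "e \<prec> \<alpha>"
    then have "(\<alpha>, e) \<notin> r" "e \<in> K" by (auto simp: le_iff dest: lt_Field)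
    with sup obtain x where "x \<in> X" "(x, e) \<notin> r"
      by (auto simp: is_sup_def)
    with assms \<open>e \<in> K\<close> show "\<exists>x\<in>X. e \<prec> x \<and> x \<prec> \<alpha>"
      by (metis le_iff lt_Field mem_underS subsetD)
  qed fact
next
  assume lpt: "lpt X \<alpha>"
  have "(x, \<alpha>) \<in> r" if "x \<in> X" for x
    using that assms(1) by (auto simp: olt_def underS_def)
  moreover have "(\<alpha>, t) \<in> r" if "t \<in> K" "\<forall>x\<in>X. (x, t) \<in> r" for t
    using that lpt by (metis le_iff lpt_Field lpt_def)
  ultimately show "is_sup r X \<alpha>"
    using lpt lpt_Field by (auto simp: is_sup_def)
qed

lemma is_sup_Int_iff: "onz r \<alpha> \<and> is_sup r (X \<inter> underS r \<alpha>) \<alpha> \<longleftrightarrow> lpt X \<alpha>"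
  by (metis Int_iff Int_lower2 is_sup_iff lpt_mono lpt_onz mem_underS)

lemma acc_eq: "acc r X = {\<alpha> \<in> X. lpt X \<alpha>}"
  by (auto simp: acc_def is_sup_Int_iff)

lemma closed_in_ord_iff:
  "closed_in_ord r C \<alpha> \<longleftrightarrow> C \<subseteq> underS r \<alpha> \<and> (\<forall>\<gamma>. \<gamma> \<prec> \<alpha> \<longrightarrow> lpt C \<gamma> \<longrightarrow> \<gamma> \<in> C)"
  by (auto simp: closed_in_ord_def is_sup_Int_iff)

lemma club_iff:
  "club r D \<longleftrightarrow> D \<subseteq> K \<and> (\<forall>\<beta>\<in>K. \<exists>\<gamma>\<in>D. \<beta> \<prec> \<gamma>) \<and> (\<forall>\<alpha>. lpt D \<alpha> \<longrightarrow> \<alpha> \<in> D)"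
  unfolding club_def unbounded_def is_sup_Int_iff using lpt_Field by blast

section \<open>Closure points, intersections of clubs, pressing down\<close>

definition closed_under :: "('a \<Rightarrow> 'a) \<Rightarrow> 'a \<Rightarrow> bool" where
  "closed_under h \<beta> \<longleftrightarrow> onz r \<beta> \<and> (\<forall>a. a \<prec> \<beta> \<longrightarrow> h a \<prec> \<beta>)"

lemma ex_closed_under:
  assumes h: "\<And>a. a \<in> K \<Longrightarrow> h a \<in> K" and "b \<in> K"
  obtains \<beta> where "b \<prec> \<beta>" "closed_under h \<beta>"
proof -
  have "\<exists>c. a \<prec> c \<and> h a \<prec> c \<and> (\<forall>x. x \<prec> a \<longrightarrow> h x \<prec> c)" if a: "a \<in> K" for a
  proof -
    obtain c0 where "c0 \<in> K" "\<And>x. x \<prec> a \<Longrightarrow> h x \<prec> c0"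
      using ex_bound_underS[OF a, of h] h lt_Field by metis
    moreover obtain c1 where "a \<prec> c1" "h a \<prec> c1"
      using ex_greater a h by metis
    moreover obtain c where "c0 \<prec> c" "c1 \<prec> c"
      using ex_greater calculation lt_Field by metis
    ultimately show ?thesis by (meson lt_trans)
  qed
  then obtain n where n: "\<And>a. a \<in> K \<Longrightarrow> a \<prec> n a"
    "\<And>a x. a \<in> K \<Longrightarrow> x \<prec> a \<or> x = a \<Longrightarrow> h x \<prec> n a"
    by metis
  \<comment> \<open>\<open>h\<close> need not be monotone, so \<open>n a\<close> dominates
    \<open>h\<close> at every argument up to and including \<open>a\<close>. The least strict upper
    bound of the iterates of \<open>n\<close> is then closed under \<open>h\<close>; it exists
    because countable sets are bounded.\<close>
  define s where "s k = (n ^^ k) b" for k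
  have sK: "s k \<in> K" for k
    by (induction k) (use \<open>b \<in> K\<close> n(1) lt_Field in \<open>auto simp: s_def\<close>)
  let ?U = "{d \<in> K. \<forall>k. s k \<prec> d}"
  have "|range s| <o r" by (simp add: countable_ordLess)
  moreover have "range s \<subseteq> K" using sK by blast
  ultimately obtain d where "d \<in> K" "\<And>x. x \<in> range s \<Longrightarrow> x \<prec> d"
    using ex_upper_bound by blast
  then have "?U \<noteq> {}" by blast
  then obtain \<beta> where \<beta>: "\<beta> \<in> ?U" "\<And>x. x \<in> ?U \<Longrightarrow> \<not> x \<prec> \<beta>"
    using ex_least[of ?U] by blast
  have "h a \<prec> \<beta>" if "a \<prec> \<beta>" for a
  proof -
    have "a \<notin> ?U" "a \<in> K" using \<beta>(2) that lt_Field by blast+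
    then obtain k where "\<not> s k \<prec> a" by blast
    then have "h a \<prec> n (s k)"
      using n(2) sK \<open>a \<in> K\<close> lt_linear by blast
    moreover have "n (s k) = s (Suc k)" by (simp add: s_def)
    moreover have "s (Suc k) \<prec> \<beta>" using \<beta>(1) by blast
    ultimately show ?thesis using lt_trans by metis
  qed
  moreover have "b \<prec> \<beta>"
    using \<beta>(1) by (auto simp: s_def dest: spec[of _ 0])
  ultimately show thesis
    using that by (auto simp: closed_under_def onz_def)
qed

text \<open>Unboundedness is reduced to containing all closure points of a single function.
  Intersecting clubs then amounts to merging their functions into one that dominates them.\<close>

lemma clubI:
  assumes "D \<subseteq> K" "\<And>\<alpha>. lpt D \<alpha> \<Longrightarrow> \<alpha> \<in> D"
    and "\<And>a. a \<in> K \<Longrightarrow> h a \<in> K" "\<And>\<beta>. closed_under h \<beta> \<Longrightarrow> \<beta> \<in> D"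
  shows "club r D"
  using assms ex_closed_under[of h] unfolding club_iff by metis

lemma club_closed_under:
  assumes "\<And>a. a \<in> K \<Longrightarrow> h a \<in> K"
  shows "club r {\<beta>. closed_under h \<beta>}"
proof (rule clubI[OF _ _ assms])
  fix \<alpha> assume "lpt {\<beta>. closed_under h \<beta>} \<alpha>"
  then show "\<alpha> \<in> {\<beta>. closed_under h \<beta>}"
    unfolding closed_under_def lpt_def by (auto intro: lt_trans)
qed (auto simp: closed_under_def onz_def dest: lt_Field)

lemma club_closure:
  assumes "club r D"
  obtains h where "\<And>a. a \<in> K \<Longrightarrow> h a \<in> D \<and> a \<prec> h a"
    "\<And>\<beta>. closed_under h \<beta> \<Longrightarrow> lpt D \<beta>"
proof -
  obtain h where h: "\<And>a. a \<in> K \<Longrightarrow> h a \<in> D \<and> a \<prec> h a"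
    using assms unfolding club_iff by metis
  then have "lpt D \<beta>" if "closed_under h \<beta>" for \<beta>
    using that unfolding lpt_def closed_under_def by (meson lt_Field)
  with h that show thesis by blast
qed

text \<open>A function bounding all \<open>g i x\<close> with \<open>i\<close> below
  \<open>a\<close> exists by regularity, and its closure points are limits of every
  \<open>D i\<close>. The factor \<open>K\<close> supplies the value of the empty intersection when
  \<open>a\<close> is 0.\<close>

lemma club_INT:
  assumes "a \<in> K" "\<And>i. i \<prec> a \<Longrightarrow> club r (D i)"
  shows "club r (K \<inter> (\<Inter>i\<in>underS r a. D i))" (is "club r ?D")
proof -
  have "\<forall>i\<in>underS r a. \<exists>h. (\<forall>x\<in>K. h x \<in> D i \<and> x \<prec> h x)"
    using assms(2) club_closure by (metis mem_underS)
  then obtain g where g: "\<And>i x. i \<prec> a \<Longrightarrow> x \<in> K \<Longrightarrow> g i x \<in> D i \<and> x \<prec> g i x"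
    by (metis mem_underS)
  have "\<exists>b. b \<in> K \<and> (\<forall>i. i \<prec> a \<longrightarrow> g i x \<prec> b)" if "x \<in> K" for x
    using ex_bound_underS[OF assms(1), of "\<lambda>i. g i x"] g that lt_Field by metis
  then obtain h where h: "\<And>x. x \<in> K \<Longrightarrow> h x \<in> K"
      "\<And>x i. x \<in> K \<Longrightarrow> i \<prec> a \<Longrightarrow> g i x \<prec> h x"
    by metis
  show ?thesis
  proof (rule clubI[of _ h])
    fix \<alpha> assume "lpt ?D \<alpha>"
    then have "lpt (D i) \<alpha>" if "i \<prec> a" for i
      by (rule lpt_mono) (use that in auto)
    then show "\<alpha> \<in> ?D"
      using \<open>lpt ?D \<alpha>\<close> assms(2) lpt_Field by (auto simp: club_iff)
  next
    fix \<beta> assume \<beta>: "closed_under h \<beta>"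
    have "lpt (D i) \<beta>" if "i \<prec> a" for i
      unfolding lpt_def
    proof (intro conjI allI impI)
      fix e assume "e \<prec> \<beta>"
      then show "\<exists>x\<in>D i. e \<prec> x \<and> x \<prec> \<beta>"
        using \<beta> g h that unfolding closed_under_def by (meson lt_Field lt_trans)
    qed (use \<beta> in \<open>simp add: closed_under_def\<close>)
    then show "\<beta> \<in> ?D"
      using \<beta> assms(2) lt_Field by (auto simp: club_iff closed_under_def onz_def)
  qed (use h in auto)
qed

lemma club_Int:
  assumes "club r D" "club r E"
  shows "club r (D \<inter> E)"
proof -
  obtain d where d: "\<And>a. a \<in> K \<Longrightarrow> d a \<in> D \<and> a \<prec> d a" "\<And>\<beta>. closed_under d \<beta> \<Longrightarrow> lpt D \<beta>"
    using club_closure[OF assms(1)] by blast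
  obtain e where e: "\<And>a. a \<in> K \<Longrightarrow> e a \<in> E \<and> a \<prec> e a" "\<And>\<beta>. closed_under e \<beta> \<Longrightarrow> lpt E \<beta>"
    using club_closure[OF assms(2)] by blast
  have "\<exists>c. d x \<prec> c \<and> e x \<prec> c" if "x \<in> K" for x
    using ex_greater[of "d x" "e x"] d(1)[OF that] e(1)[OF that] lt_Field by metis
  then obtain h where h: "\<And>x. x \<in> K \<Longrightarrow> d x \<prec> h x \<and> e x \<prec> h x"
    by metis
  show ?thesis
  proof (rule clubI[of _ h])
    fix \<alpha> assume "lpt (D \<inter> E) \<alpha>"
    then have "lpt D \<alpha>" "lpt E \<alpha>" by (auto elim: lpt_mono)
    then show "\<alpha> \<in> D \<inter> E" using assms by (auto simp: club_iff)
  next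
    fix \<beta> assume "closed_under h \<beta>"
    then have "closed_under d \<beta>" "closed_under e \<beta>"
      unfolding closed_under_def using h lt_Field lt_trans by meson+
    then show "\<beta> \<in> D \<inter> E" using d(2) e(2) assms by (auto simp: club_iff)
  qed (use assms h lt_Field in \<open>auto simp: club_iff\<close>)
qed

lemma club_lpt:
  assumes "club r D"
  shows "club r {\<delta>. lpt D \<delta>}"
proof -
  obtain h where h: "\<And>a. a \<in> K \<Longrightarrow> h a \<in> D \<and> a \<prec> h a" "\<And>\<beta>. closed_under h \<beta> \<Longrightarrow> lpt D \<beta>"
    using club_closure[OF assms] by blast
  show ?thesis
    by (rule clubI[of _ h]) (use h lpt_Field lpt_lpt lt_Field in blast)+
qed

lemma stationaryE:
  assumes "stationary r S" "club r D"
  obtains \<alpha> where "\<alpha> \<in> S" "lpt D \<alpha>" "\<alpha> \<in> D"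
  using assms(1) club_lpt[OF assms(2)] assms(2) unfolding stationary_def club_iff[of D] by blast

text \<open>A weak form of Fodor's lemma: bounded values at unboundedly many points are all that a
  thread requires. If it failed, each \<tau> would have an \<open>h \<tau>\<close> bounding all
  relevant \<alpha> with \<open>t \<alpha>\<close> at most \<tau>; an \<alpha> closed under
  \<open>h\<close> contradicts this at \<tau> = \<open>t \<alpha>\<close>.\<close>

lemma regressive_on_stationary:
  assumes "stationary r S" "club r D" "\<And>\<alpha>. \<alpha> \<in> S \<Longrightarrow> lpt D \<alpha> \<Longrightarrow> t \<alpha> \<prec> \<alpha>"
  obtains \<tau> where "\<tau> \<in> K" "\<And>b. b \<in> K \<Longrightarrow> \<exists>\<alpha>\<in>S. b \<prec> \<alpha> \<and> lpt D \<alpha> \<and> \<not> \<tau> \<prec> t \<alpha>"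
proof (rule ccontr)
  assume "\<not> thesis"
  then have "\<forall>\<tau>\<in>K. \<exists>b\<in>K. \<forall>\<alpha>\<in>S. lpt D \<alpha> \<longrightarrow> \<not> \<tau> \<prec> t \<alpha> \<longrightarrow> \<not> b \<prec> \<alpha>"
    using that by blast
  then obtain h where h: "\<And>\<tau>. \<tau> \<in> K \<Longrightarrow> h \<tau> \<in> K"
    "\<And>\<tau> \<alpha>. \<tau> \<in> K \<Longrightarrow> \<alpha> \<in> S \<Longrightarrow> lpt D \<alpha> \<Longrightarrow> \<not> \<tau> \<prec> t \<alpha> \<Longrightarrow> \<not> h \<tau> \<prec> \<alpha>"
    by metis
  obtain \<alpha> where \<alpha>: "\<alpha> \<in> S" "lpt ({\<beta>. closed_under h \<beta>} \<inter> D) \<alpha>" "closed_under h \<alpha>"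
    using stationaryE[OF assms(1) club_Int[OF club_closed_under assms(2)], of h] h(1) by blast
  then have "lpt D \<alpha>" by (auto elim: lpt_mono)
  then have "t \<alpha> \<prec> \<alpha>" using assms(3) \<alpha>(1) by blast
  then have "h (t \<alpha>) \<prec> \<alpha>" using \<alpha>(3) by (simp add: closed_under_def)
  moreover have "\<not> h (t \<alpha>) \<prec> \<alpha>"
    using h(2) \<open>lpt D \<alpha>\<close> \<alpha>(1) \<open>t \<alpha> \<prec> \<alpha>\<close> lt_Field lt_irrefl by blast
  ultimately show False by contradiction
qed

lemma lpt_infinite:
  assumes "lpt X \<delta>" "e \<prec> \<delta>"
  shows "infinite {x \<in> X. e \<prec> x \<and> x \<prec> \<delta>}" (is "infinite ?Y")
proof
  assume fin: "finite ?Y"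
  have step: "\<exists>y. y \<in> ?Y \<and> x \<prec> y" if "x \<in> ?Y" for x
  proof -
    have "x \<prec> \<delta>" "e \<prec> x" using that by auto
    moreover obtain y where "y \<in> X" "x \<prec> y" "y \<prec> \<delta>"
      using lptE[OF assms(1) calculation(1)] by blast
    ultimately show ?thesis using lt_trans by blast
  qed
  have "?Y = {}"
    by (rule finite_transitivity_chain[OF fin lt_irrefl lt_trans step])
  then show False
    using assms by (auto elim: lptE)
qed

section \<open>Coherent ladders and their passage to and from C-sequences\<close>

text \<open>Coherence for limit indices only; at \<open>0\<close> and at successors a \<open>C\<close>-sequence carries no
  information, and its values are filled in by \<open>ladder_C_sequence\<close>.\<close>

definition coherent_ladder :: "('a \<Rightarrow> 'a set) \<Rightarrow> bool" where
  "coherent_ladder C \<longleftrightarrow> (\<forall>\<alpha>. lpt K \<alpha> \<longrightarrow> C \<alpha> \<subseteq> underS r \<alpha> \<and> lpt (C \<alpha>) \<alpha> \<and>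
     (\<forall>\<gamma>. \<gamma> \<prec> \<alpha> \<longrightarrow> lpt (C \<alpha>) \<gamma> \<longrightarrow> \<gamma> \<in> C \<alpha> \<and> C \<gamma> = C \<alpha> \<inter> underS r \<gamma>))"

lemma is_sup_unique: "is_sup r X s \<Longrightarrow> is_sup r X t \<Longrightarrow> s = t"
  unfolding is_sup_def by (metis le_iff lt_linear)

lemma C_sequence_ladder:
  assumes "C_sequence r C" "coherent r C"
  shows "coherent_ladder C"
  unfolding coherent_ladder_def
proof (intro allI impI)
  fix \<alpha> assume \<alpha>: "lpt K \<alpha>"
  then have "lpt (underS r \<alpha>) \<alpha>" by (rule lpt_mono) simp
  then have "is_sup r (underS r \<alpha>) \<alpha>"
    using is_sup_iff lpt_onz by blast
  with assms(1) \<alpha> have "closed_in_ord r (C \<alpha>) \<alpha>" "is_sup r (C \<alpha>) \<alpha>"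
    unfolding C_sequence_def using is_sup_unique lpt_Field by blast+
  with assms(2) \<alpha> show "C \<alpha> \<subseteq> underS r \<alpha> \<and> lpt (C \<alpha>) \<alpha> \<and>
     (\<forall>\<gamma>. \<gamma> \<prec> \<alpha> \<longrightarrow> lpt (C \<alpha>) \<gamma> \<longrightarrow> \<gamma> \<in> C \<alpha> \<and> C \<gamma> = C \<alpha> \<inter> underS r \<gamma>)"
    using is_sup_iff lpt_onz lpt_Field by (auto simp: closed_in_ord_iff coherent_def acc_eq)
qed

lemma ladder_C_sequence:
  assumes "coherent_ladder C"
  obtains C' where "C_sequence r C'" "coherent r C'" "\<And>\<alpha>. lpt K \<alpha> \<Longrightarrow> C' \<alpha> = C \<alpha>"
proof
  \<comment> \<open>Off the limits the value is the set of maximal elements below \<alpha>: a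
    singleton at successors, empty at 0. It has the supremum demanded of a C-sequence and no limit
    points, so coherence is unaffected.\<close>
  define C' where
    "C' \<alpha> = (if lpt K \<alpha> then C \<alpha> else {\<beta>. \<beta> \<prec> \<alpha> \<and> (\<forall>\<gamma>. \<gamma> \<prec> \<alpha> \<longrightarrow> \<not> \<beta> \<prec> \<gamma>)})" for \<alpha>
  show "C' \<alpha> = C \<alpha>" if "lpt K \<alpha>" for \<alpha>
    using that by (simp add: C'_def)
  have no_lpt: "\<not> lpt (C' \<alpha>) \<gamma>" if "\<not> lpt K \<alpha>" for \<alpha> \<gamma>
  proof
    assume lpt: "lpt (C' \<alpha>) \<gamma>"
    then obtain x where x: "x \<in> C' \<alpha>" "x \<prec> \<gamma>" unfolding lpt_def onz_def by blast
    obtain y where "y \<in> C' \<alpha>" "x \<prec> y" using lptE[OF lpt x(2)] by blast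
    with x that show False by (auto simp: C'_def)
  qed
  have "closed_in_ord r (C' \<alpha>) \<alpha> \<and> (\<exists>s. is_sup r (C' \<alpha>) s \<and> is_sup r (underS r \<alpha>) s)"
    if "\<alpha> \<in> K" for \<alpha>
  proof (cases "lpt K \<alpha>")
    case True
    then have "lpt (underS r \<alpha>) \<alpha>" by (rule lpt_mono) simp
    with True assms show ?thesis
      using is_sup_iff[OF _ lpt_onz[OF True], of "C \<alpha>"]
        is_sup_iff[OF _ lpt_onz[OF True], of "underS r \<alpha>"]
      unfolding closed_in_ord_iff coherent_ladder_def C'_def by auto
  next
    case False
    have "\<exists>s. is_sup r (C' \<alpha>) s \<and> is_sup r (underS r \<alpha>) s"
    proof (cases "onz r \<alpha>")
      case True
      with False obtain e where e: "e \<prec> \<alpha>" "\<And>\<gamma>. \<gamma> \<prec> \<alpha> \<Longrightarrow> \<not> e \<prec> \<gamma>"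
        unfolding lpt_def by (metis lt_Field)
      then have "\<beta> = e" if "\<beta> \<prec> \<alpha>" "\<not> \<beta> \<prec> e" for \<beta>
        using that lt_linear lt_Field by blast
      with e have "C' \<alpha> = {e}"
        using \<open>\<not> lpt K \<alpha>\<close> unfolding C'_def by auto
      moreover have "is_sup r {e} e" "is_sup r (underS r \<alpha>) e"
        using e lt_Field by (auto simp: is_sup_def le_iff)
      ultimately show ?thesis by auto
    next
      case False
      then have "C' \<alpha> = {}" "underS r \<alpha> = {}"
        using lpt_onz by (auto simp: C'_def onz_def)
      moreover have "is_sup r {} \<alpha>"
        using False \<open>\<alpha> \<in> K\<close> by (auto simp: is_sup_def le_iff onz_def)
      ultimately show ?thesis by auto
    qed
    moreover have "C' \<alpha> \<subseteq> underS r \<alpha>"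
      using False by (auto simp: C'_def)
    ultimately show ?thesis
      using no_lpt[OF False] by (auto simp: closed_in_ord_iff)
  qed
  then show "C_sequence r C'"
    by (simp add: C_sequence_def)
  show "coherent r C'"
    unfolding coherent_def acc_eq
  proof (intro ballI)
    fix \<alpha> \<beta> assume "\<alpha> \<in> K" "\<beta> \<in> {\<beta> \<in> C' \<alpha>. lpt (C' \<alpha>) \<beta>}"
    then have "lpt K \<alpha>" "lpt (C' \<alpha>) \<beta>" "\<beta> \<in> C' \<alpha>" using no_lpt by blast+
    moreover from this have "C' \<alpha> = C \<alpha>" "C' \<beta> = C \<beta>"
      using lpt_K by (auto simp: C'_def)
    moreover have "C \<alpha> \<subseteq> underS r \<alpha>"
      using assms \<open>lpt K \<alpha>\<close> by (simp add: coherent_ladder_def)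
    ultimately have "\<beta> \<prec> \<alpha>" "lpt (C \<alpha>) \<beta>" by auto
    then have "C \<beta> = C \<alpha> \<inter> underS r \<beta>"
      using assms \<open>lpt K \<alpha>\<close> unfolding coherent_ladder_def by blast
    then show "C' \<beta> = C' \<alpha> \<inter> underS r \<beta>"
      using \<open>C' \<alpha> = C \<alpha>\<close> \<open>C' \<beta> = C \<beta>\<close> by simp
  qed
qed

lemma boxtimes_minusI:
  assumes "coherent_ladder C"
    and "\<And>A. unbounded r A \<Longrightarrow> \<exists>\<alpha>\<in>S. lpt (nacc r (C \<alpha>) \<inter> A) \<alpha>"
  shows "boxtimes_minus r S"
proof -
  obtain C' where C': "C_sequence r C'" "coherent r C'" "\<And>\<alpha>. lpt K \<alpha> \<Longrightarrow> C' \<alpha> = C \<alpha>"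
    using ladder_C_sequence[OF assms(1)] by blast
  have "\<exists>\<alpha>\<in>S. onz r \<alpha> \<and> is_sup r (nacc r (C' \<alpha>) \<inter> A) \<alpha>" if "unbounded r A" for A
  proof -
    obtain \<alpha> where \<alpha>: "\<alpha> \<in> S" "lpt (nacc r (C \<alpha>) \<inter> A) \<alpha>"
      using assms(2) \<open>unbounded r A\<close> by blast
    \<comment> \<open>Guessing can only happen at a limit \<alpha>, where the completed sequence
      agrees with \<open>C\<close>.\<close>
    then have lim: "lpt K \<alpha>" using lpt_K by blast
    then have "nacc r (C \<alpha>) \<inter> A \<subseteq> underS r \<alpha>"
      using assms(1) unfolding coherent_ladder_def nacc_def by blast
    with \<alpha> lim C'(3) show ?thesis
      using is_sup_iff lpt_onz by metis
  qed
  with C' show ?thesis unfolding boxtimes_minus_def by blast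
qed

section \<open>Projecting a ladder to a club\<close>

text \<open>The supremum of the part of \<open>D\<close> below \<eta>, as a relation because it is
  undefined when \<open>D\<close> has no point below \<eta>. A point \<eta> of \<open>D\<close> that
  is not a limit of \<open>D\<close> is sent strictly below itself.\<close>

definition sup_upto :: "'a set \<Rightarrow> 'a \<Rightarrow> 'a \<Rightarrow> bool" where
  "sup_upto D \<eta> \<gamma> \<longleftrightarrow> \<gamma> \<in> D \<and> (\<gamma> \<prec> \<eta> \<and> (\<forall>d\<in>D. d \<prec> \<eta> \<longrightarrow> \<not> \<gamma> \<prec> d) \<or> \<gamma> = \<eta> \<and> lpt D \<eta>)"

lemma sup_upto_not_less: "sup_upto D \<eta> \<gamma> \<Longrightarrow> d \<in> D \<Longrightarrow> d \<prec> \<eta> \<Longrightarrow> \<not> \<gamma> \<prec> d"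
  unfolding sup_upto_def by (meson lt_irrefl lt_trans)

text \<open>The least weak upper bound of the points of \<open>X\<close> below \<eta> is the
  required maximum: outside \<open>X\<close> it would be a limit of \<open>X\<close> below \<eta>,
  against closedness.\<close>

lemma ex_max_below:
  assumes "\<And>\<gamma>. \<gamma> \<prec> \<eta> \<Longrightarrow> lpt X \<gamma> \<Longrightarrow> \<gamma> \<in> X" "\<not> lpt X \<eta>" "x \<in> X" "x \<prec> \<eta>"
  obtains \<gamma> where "\<gamma> \<in> X" "\<gamma> \<prec> \<eta>" "\<And>y. y \<in> X \<Longrightarrow> y \<prec> \<eta> \<Longrightarrow> \<not> \<gamma> \<prec> y"
proof -
  let ?U = "{e \<in> K. \<forall>y\<in>X. y \<prec> \<eta> \<longrightarrow> \<not> e \<prec> y}"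
  from assms(2,4) obtain e0 where e0: "e0 \<in> ?U" "e0 \<prec> \<eta>"
    unfolding lpt_def onz_def using lt_Field by blast
  then obtain \<gamma> where \<gamma>: "\<gamma> \<in> ?U" "\<And>e. e \<in> ?U \<Longrightarrow> \<not> e \<prec> \<gamma>"
    using ex_least[of ?U] by blast
  have "\<gamma> \<prec> \<eta>"
    using \<gamma> e0 le_lt_trans by blast
  moreover have "\<gamma> \<in> X"
  proof (rule ccontr)
    assume "\<gamma> \<notin> X"
    then have below: "y \<prec> \<gamma>" if "y \<in> X" "y \<prec> \<eta>" for y
      using \<gamma>(1) that lt_linear lt_Field by blast
    have "lpt X \<gamma>"
      unfolding lpt_def
    proof (intro conjI allI impI)
      show "onz r \<gamma>" using below assms by (auto simp: onz_def)
      fix e assume "e \<prec> \<gamma>"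
      then have "e \<notin> ?U" "e \<in> K" using \<gamma>(2) lt_Field by blast+
      with below show "\<exists>y\<in>X. e \<prec> y \<and> y \<prec> \<gamma>" by blast
    qed
    with \<open>\<gamma> \<notin> X\<close> \<open>\<gamma> \<prec> \<eta>\<close> assms(1) show False by blast
  qed
  ultimately show thesis
    using that \<gamma>(1) by blast
qed

lemma ex_sup_upto:
  assumes "club r D" "d \<in> D" "d \<prec> \<eta>"
  obtains \<gamma> where "sup_upto D \<eta> \<gamma>"
proof (cases "lpt D \<eta>")
  case True
  with assms(1) that show thesis by (auto simp: sup_upto_def club_iff)
next
  case False
  with assms obtain \<gamma> where "\<gamma> \<in> D" "\<gamma> \<prec> \<eta>" "\<And>y. y \<in> D \<Longrightarrow> y \<prec> \<eta> \<Longrightarrow> \<not> \<gamma> \<prec> y"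
    using ex_max_below[of \<eta> D d] unfolding club_iff by metis
  with that show thesis by (auto simp: sup_upto_def)
qed

text \<open>Projected values are cofinal in \<alpha> only when \<open>D\<close> is. At other
  \<alpha> the part of \<open>C \<alpha>\<close> above all points of \<open>D\<close> below \<alpha>
  is kept instead, which is still cofinal at limits and coheres with the same choice at its limit
  points.\<close>

definition club_project :: "'a set \<Rightarrow> ('a \<Rightarrow> 'a set) \<Rightarrow> 'a \<Rightarrow> 'a set" where
  "club_project D C \<alpha> = (if lpt D \<alpha> then {\<gamma>. \<exists>\<eta>\<in>C \<alpha>. sup_upto D \<eta> \<gamma>}
     else {\<eta> \<in> C \<alpha>. \<forall>d\<in>D. d \<prec> \<alpha> \<longrightarrow> d \<prec> \<eta>})"

text \<open>If \<gamma> is the projection of \<eta> and \<gamma>' is a larger projected value, then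
  \<gamma>' lies in \<open>D\<close> and so cannot be below \<eta>. Hence \<eta> lies between
  \<gamma> and \<gamma>', and \<open>C \<alpha>\<close> accumulates wherever the projected values
  do.\<close>

lemma lpt_club_project:
  assumes "lpt (club_project D C \<alpha>) \<delta>"
  shows "lpt (C \<alpha>) \<delta>"
proof (cases "lpt D \<alpha>")
  case True
  show ?thesis
    unfolding lpt_def
  proof (intro conjI allI impI)
    fix e assume "e \<prec> \<delta>"
    with assms obtain \<gamma> where \<gamma>: "\<gamma> \<in> club_project D C \<alpha>" "e \<prec> \<gamma>" "\<gamma> \<prec> \<delta>"
      by (rule lptE)
    with assms obtain \<gamma>' where \<gamma>': "\<gamma>' \<in> club_project D C \<alpha>" "\<gamma> \<prec> \<gamma>'" "\<gamma>' \<prec> \<delta>"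
      using lptE by blast
    from \<gamma> True obtain \<eta> where \<eta>: "\<eta> \<in> C \<alpha>" "sup_upto D \<eta> \<gamma>"
      by (auto simp: club_project_def)
    have "\<gamma>' \<in> D"
      using \<gamma>' True by (auto simp: club_project_def sup_upto_def)
    then have "\<not> \<gamma>' \<prec> \<eta>"
      using \<eta>(2) \<gamma>' sup_upto_not_less by blast
    moreover have "\<gamma> = \<eta> \<or> \<gamma> \<prec> \<eta>"
      using \<eta>(2) by (auto simp: sup_upto_def)
    ultimately show "\<exists>x\<in>C \<alpha>. e \<prec> x \<and> x \<prec> \<delta>"
      using \<eta>(1) \<gamma> \<gamma>' by (metis le_lt_trans lt_Field lt_trans)
  qed (rule lpt_onz[OF assms])
next
  case False
  with assms show ?thesis
    by (auto simp: club_project_def elim: lpt_mono)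
qed

lemma lpt_club_project_club:
  assumes "lpt (club_project D C \<alpha>) \<delta>" "lpt D \<alpha>"
  shows "lpt D \<delta>"
  using assms(1) by (rule lpt_mono) (use assms(2) in \<open>auto simp: club_project_def sup_upto_def\<close>)

lemma club_project_Int:
  assumes "C \<alpha> \<subseteq> underS r \<alpha>" "C \<delta> = C \<alpha> \<inter> underS r \<delta>" "\<delta> \<prec> \<alpha>" "lpt (club_project D C \<alpha>) \<delta>"
  shows "club_project D C \<delta> = club_project D C \<alpha> \<inter> underS r \<delta>"
proof (cases "lpt D \<alpha>")
  case True
  with assms(4) have \<delta>: "lpt D \<delta>" using lpt_club_project_club by blast
  \<comment> \<open>As \<delta> is a limit of \<open>D\<close>, any \<eta> at or above \<delta>
    projects to a value at or above \<delta>. So values below \<delta> come from \<eta> below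
    \<delta>.\<close>
  have up: "\<eta> \<prec> \<delta>" if "\<eta> \<in> C \<alpha>" "sup_upto D \<eta> \<gamma>" and lt: "\<gamma> \<prec> \<delta>" for \<eta> \<gamma>
  proof (rule ccontr)
    assume "\<not> \<eta> \<prec> \<delta>"
    obtain d where "d \<in> D" "\<gamma> \<prec> d" "d \<prec> \<delta>" using lptE[OF \<delta> lt] by blast
    moreover have "\<eta> \<in> K" using that(1) assms(1) lt_Field mem_underS by blast
    ultimately show False
      using that(2) \<open>\<not> \<eta> \<prec> \<delta>\<close> sup_upto_not_less lt_le_trans by blast
  qed
  have down: "\<gamma> \<prec> \<delta>" if "\<eta> \<prec> \<delta>" "sup_upto D \<eta> \<gamma>" for \<eta> \<gamma>
    using that lt_trans by (auto simp: sup_upto_def)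
  have "{\<gamma>. \<exists>\<eta>\<in>C \<delta>. sup_upto D \<eta> \<gamma>} = {\<gamma>. \<exists>\<eta>\<in>C \<alpha>. sup_upto D \<eta> \<gamma>} \<inter> underS r \<delta>"
    unfolding assms(2) using up down by (simp add: set_eq_iff Bex_def) blast
  with True \<delta> show ?thesis by (simp add: club_project_def)
next
  case False
  \<comment> \<open>A point \<open>x\<close> of the kept tail below \<delta> lies above all points
    of \<open>D\<close> below \<alpha>. Thus \<open>D\<close> has the same points below \<delta> as
    below \<alpha>, and both indices fall under the same case and the same tail condition.\<close>
  obtain x where x: "x \<in> club_project D C \<alpha>" "x \<prec> \<delta>"
    using assms(4) unfolding lpt_def onz_def by blast
  then have D: "d \<prec> x" if "d \<in> D" "d \<prec> \<alpha>" for d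
    using False that by (auto simp: club_project_def)
  have "\<not> lpt D \<delta>"
  proof
    assume "lpt D \<delta>"
    then obtain d where "d \<in> D" "x \<prec> d" "d \<prec> \<delta>" using x by (auto elim: lptE)
    then show False using D assms(3) lt_trans lt_irrefl by blast
  qed
  moreover have "d \<prec> \<delta> \<longleftrightarrow> d \<prec> \<alpha>" if "d \<in> D" for d
    using that D x assms(3) lt_trans by blast
  ultimately show ?thesis
    using False assms(2) by (auto simp: club_project_def)
qed

lemma club_project_subset:
  assumes "C \<alpha> \<subseteq> underS r \<alpha>"
  shows "club_project D C \<alpha> \<subseteq> underS r \<alpha>"
proof
  fix \<gamma> assume "\<gamma> \<in> club_project D C \<alpha>"
  then obtain \<eta> where "\<eta> \<in> C \<alpha>" "\<gamma> \<prec> \<eta> \<or> \<gamma> = \<eta>"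
    by (auto simp: club_project_def sup_upto_def split: if_splits)
  with assms lt_trans show "\<gamma> \<in> underS r \<alpha>"
    unfolding subset_eq mem_underS by blast
qed

lemma coherent_ladder_project:
  assumes "club r D" "coherent_ladder C"
  shows "coherent_ladder (club_project D C)"
  unfolding coherent_ladder_def
proof (intro allI impI conjI)
  fix \<alpha> assume \<alpha>: "lpt K \<alpha>"
  with assms(2) have C: "C \<alpha> \<subseteq> underS r \<alpha>" "lpt (C \<alpha>) \<alpha>"
    "\<And>\<gamma>. \<gamma> \<prec> \<alpha> \<Longrightarrow> lpt (C \<alpha>) \<gamma> \<Longrightarrow> \<gamma> \<in> C \<alpha> \<and> C \<gamma> = C \<alpha> \<inter> underS r \<gamma>"
    by (auto simp: coherent_ladder_def)
  show "club_project D C \<alpha> \<subseteq> underS r \<alpha>"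
    by (rule club_project_subset) fact
  show "lpt (club_project D C \<alpha>) \<alpha>"
    unfolding lpt_def
  proof (intro conjI allI impI)
    fix e assume "e \<prec> \<alpha>"
    show "\<exists>x\<in>club_project D C \<alpha>. e \<prec> x \<and> x \<prec> \<alpha>"
    proof (cases "lpt D \<alpha>")
      case True
      then obtain d where d: "d \<in> D" "e \<prec> d" "d \<prec> \<alpha>" using \<open>e \<prec> \<alpha>\<close> by (rule lptE)
      with C(2) obtain \<eta> where \<eta>: "\<eta> \<in> C \<alpha>" "d \<prec> \<eta>" "\<eta> \<prec> \<alpha>" by (auto elim: lptE)
      then obtain \<gamma> where \<gamma>: "sup_upto D \<eta> \<gamma>" using ex_sup_upto assms(1) d by blast
      moreover have "\<gamma> \<in> K"
        using \<gamma> assms(1) by (auto simp: sup_upto_def club_iff)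
      moreover have "e \<prec> \<gamma>"
        using d \<eta> \<gamma> \<open>\<gamma> \<in> K\<close> sup_upto_not_less lt_le_trans by blast
      moreover have "\<gamma> \<prec> \<alpha>"
        using \<gamma> \<eta> lt_trans by (auto simp: sup_upto_def)
      ultimately show ?thesis using True \<eta> by (auto simp: club_project_def)
    next
      case False
      then obtain e' where e': "e' \<prec> \<alpha>" "\<And>d. d \<in> D \<Longrightarrow> d \<prec> \<alpha> \<Longrightarrow> \<not> e' \<prec> d"
        using \<open>e \<prec> \<alpha>\<close> unfolding lpt_def onz_def by blast
      obtain \<eta> where \<eta>: "\<eta> \<in> C \<alpha>" "e \<prec> \<eta>" "e' \<prec> \<eta>" "\<eta> \<prec> \<alpha>"
        using lptE2[OF C(2) \<open>e \<prec> \<alpha>\<close> e'(1)] by blast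
      have "d \<prec> \<eta>" if "d \<in> D" "d \<prec> \<alpha>" for d
        using e'(2)[OF that] \<eta> that by (meson le_lt_trans lt_Field)
      with False \<eta> show ?thesis
        by (auto simp: club_project_def)
    qed
  qed (use \<alpha> lpt_onz in auto)
  fix \<gamma> assume \<gamma>: "\<gamma> \<prec> \<alpha>" "lpt (club_project D C \<alpha>) \<gamma>"
  then have \<gamma>C: "\<gamma> \<in> C \<alpha>" "C \<gamma> = C \<alpha> \<inter> underS r \<gamma>"
    using C(3) lpt_club_project by blast+
  then show "club_project D C \<gamma> = club_project D C \<alpha> \<inter> underS r \<gamma>"
    using club_project_Int C(1) \<gamma> by blast
  show "\<gamma> \<in> club_project D C \<alpha>"
  proof (cases "lpt D \<alpha>")
    case True
    \<comment> \<open>A limit of \<open>D\<close> that belongs to \<open>C \<alpha>\<close> is its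
      own projection.\<close>
    then have "lpt D \<gamma>" using \<gamma> lpt_club_project_club by blast
    moreover from this have "\<gamma> \<in> D" using assms(1) by (auto simp: club_iff)
    ultimately show ?thesis using True \<gamma>C by (auto simp: club_project_def sup_upto_def)
  next
    case False
    obtain x where x: "x \<in> club_project D C \<alpha>" "x \<prec> \<gamma>"
      using \<gamma>(2) unfolding lpt_def onz_def by blast
    with False \<gamma>C show ?thesis
      by (auto simp: club_project_def intro: lt_trans)
  qed
qed

section \<open>Inserting finitely many points into each gap of a ladder\<close>

definition consecutive :: "'a set \<Rightarrow> 'a \<Rightarrow> 'a \<Rightarrow> bool" where
  "consecutive X a b \<longleftrightarrow> a \<in> X \<and> b \<in> X \<and> a \<prec> b \<and> (\<forall>x\<in>X. a \<prec> x \<longrightarrow> \<not> x \<prec> b)"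

text \<open>\<open>G\<close> sees only the two endpoints of a gap and not the index \<alpha> of the
  ladder; this lets filling commute with initial segments.\<close>

definition fill_gaps :: "('a \<Rightarrow> 'a \<Rightarrow> 'a set) \<Rightarrow> 'a set \<Rightarrow> 'a set" where
  "fill_gaps G X = X \<union> {\<xi>. \<exists>a b. consecutive X a b \<and> a \<prec> \<xi> \<and> \<xi> \<prec> b \<and> \<xi> \<in> G a b}"

lemma consecutive_Field: "consecutive X a b \<Longrightarrow> a \<in> K \<and> b \<in> K"
  by (auto simp: consecutive_def dest: lt_Field)

lemma consecutive_unique:
  assumes "consecutive X a b" "a \<prec> \<xi>" "\<xi> \<prec> b" "consecutive X a' b'" "a' \<prec> \<xi>" "\<xi> \<prec> b'"
  shows "a = a' \<and> b = b'"
proof -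
  have "\<not> a \<prec> x" if "consecutive X a b" "\<xi> \<prec> b" "x \<in> X" "x \<prec> \<xi>" for a b x
    using that lt_trans unfolding consecutive_def by blast
  moreover have "\<not> x \<prec> b" if "consecutive X a b" "a \<prec> \<xi>" "x \<in> X" "\<xi> \<prec> x" for a b x
    using that lt_trans unfolding consecutive_def by blast
  moreover have "a \<in> X" "b \<in> X" "a' \<in> X" "b' \<in> X"
    using assms unfolding consecutive_def by blast+
  ultimately have "\<not> a \<prec> a'" "\<not> a' \<prec> a" "\<not> b \<prec> b'" "\<not> b' \<prec> b"
    using assms by blast+
  then show ?thesis
    using lt_linear consecutive_Field assms(1,4) by blast
qed

text \<open>If \<open>X\<close> had no point strictly between \<open>e\<close> and \<delta>, all
  filled points there would come from one gap and be finite in number, whereas a limit has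
  infinitely many points in that interval.\<close>

lemma lpt_fill_gaps:
  assumes "lpt (fill_gaps G X) \<delta>" "\<And>a b. consecutive X a b \<Longrightarrow> finite (G a b)"
  shows "lpt X \<delta>"
  unfolding lpt_def
proof (intro conjI allI impI)
  fix e assume "e \<prec> \<delta>"
  show "\<exists>x\<in>X. e \<prec> x \<and> x \<prec> \<delta>"
  proof (rule ccontr)
    assume none: "\<not> ?thesis"
    let ?Y = "{x \<in> fill_gaps G X. e \<prec> x \<and> x \<prec> \<delta>}"
    have Y: "\<exists>a b. consecutive X a b \<and> \<not> e \<prec> a \<and> \<not> b \<prec> \<delta> \<and> a \<prec> \<xi> \<and> \<xi> \<prec> b \<and> \<xi> \<in> G a b"
      if "\<xi> \<in> ?Y" for \<xi>
    proof -
      from that none obtain a b where ab: "consecutive X a b" "a \<prec> \<xi>" "\<xi> \<prec> b" "\<xi> \<in> G a b"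
        by (auto simp: fill_gaps_def)
      have "a \<prec> \<delta>" "e \<prec> b" using that ab lt_trans by blast+
      with ab(1) none have "\<not> e \<prec> a" "\<not> b \<prec> \<delta>"
        unfolding consecutive_def by blast+
      with ab show ?thesis by blast
    qed
    obtain \<xi> where \<xi>: "\<xi> \<in> ?Y" using assms(1) \<open>e \<prec> \<delta>\<close> by (auto elim: lptE)
    obtain a b where ab: "consecutive X a b" "\<not> e \<prec> a" "\<not> b \<prec> \<delta>"
      using Y[OF \<xi>] by blast
    have "?Y \<subseteq> G a b"
    proof
      fix \<zeta> assume \<zeta>: "\<zeta> \<in> ?Y"
      then obtain a' b' where ab': "consecutive X a' b'" "a' \<prec> \<zeta>" "\<zeta> \<prec> b'" "\<zeta> \<in> G a' b'"
        using Y[OF \<zeta>] by blast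
      moreover have "a \<prec> \<zeta>" "\<zeta> \<prec> b"
        using ab \<zeta> consecutive_Field[OF ab(1)] le_lt_trans lt_le_trans by blast+
      ultimately show "\<zeta> \<in> G a b"
        using consecutive_unique ab(1) by metis
    qed
    then have "finite ?Y" using assms(2) ab(1) finite_subset by blast
    then show False using lpt_infinite assms(1) \<open>e \<prec> \<delta>\<close> by blast
  qed
qed (rule lpt_onz[OF assms(1)])

lemma lpt_not_in_gap:
  assumes "consecutive X a b" "a \<prec> \<xi>" "\<xi> \<prec> b \<or> \<xi> = b"
  shows "\<not> lpt X \<xi>"
proof
  assume "lpt X \<xi>"
  then obtain x where "x \<in> X" "a \<prec> x" "x \<prec> \<xi>"
    using assms(2) by (rule lptE)
  with assms lt_trans show False
    unfolding consecutive_def by blast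
qed

text \<open>A gap of \<open>X\<close> contributing a point below \<delta> must end below \<delta>:
  it cannot straddle \<delta>, which is in \<open>X\<close>, nor end at \<delta>, which is a limit
  of \<open>X\<close>.\<close>

lemma fill_gaps_Int:
  assumes "lpt X \<delta>" "\<delta> \<in> X"
  shows "fill_gaps G (X \<inter> underS r \<delta>) = fill_gaps G X \<inter> underS r \<delta>"
proof -
  have 1: "consecutive (X \<inter> underS r \<delta>) a b \<longleftrightarrow> consecutive X a b \<and> b \<prec> \<delta>" for a b
  proof (cases "b \<prec> \<delta>")
    case True
    then have below: "x \<prec> \<delta>" if "x \<prec> b" for x
      using that lt_trans by blast
    then have "(\<forall>x\<in>X \<inter> underS r \<delta>. a \<prec> x \<longrightarrow> \<not> x \<prec> b) \<longleftrightarrow> (\<forall>x\<in>X. a \<prec> x \<longrightarrow> \<not> x \<prec> b)"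
      by auto
    with True below show ?thesis
      unfolding consecutive_def by auto
  qed (simp add: consecutive_def)
  have 2: "b \<prec> \<delta>" if "consecutive X a b" "a \<prec> \<xi>" "\<xi> \<prec> b" "\<xi> \<prec> \<delta>" for a b \<xi>
  proof -
    have "\<not> \<delta> \<prec> b"
      using that assms(2) lt_trans unfolding consecutive_def by blast
    moreover have "\<delta> \<noteq> b"
      using that assms(1) lpt_not_in_gap[OF that(1)] lt_trans by blast
    ultimately show ?thesis using that lt_linear lt_Field by blast
  qed
  show ?thesis
  proof (rule set_eqI)
    fix \<xi>
    have "\<xi> \<prec> \<delta>" if "\<xi> \<prec> b" "b \<prec> \<delta>" for b
      using that lt_trans by blast
    with 2 show "\<xi> \<in> fill_gaps G (X \<inter> underS r \<delta>) \<longleftrightarrow> \<xi> \<in> fill_gaps G X \<inter> underS r \<delta>"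
      unfolding fill_gaps_def 1 Un_iff Int_iff mem_Collect_eq mem_underS by blast
  qed
qed

lemma coherent_ladder_fill_gaps:
  assumes "coherent_ladder C" "\<And>a b. a \<prec> b \<Longrightarrow> finite (G a b)"
  shows "coherent_ladder (\<lambda>\<alpha>. fill_gaps G (C \<alpha>))"
  unfolding coherent_ladder_def
proof (intro allI impI conjI)
  fix \<alpha> assume \<alpha>: "lpt K \<alpha>"
  with assms(1) have C: "C \<alpha> \<subseteq> underS r \<alpha>" "lpt (C \<alpha>) \<alpha>"
    "\<And>\<gamma>. \<gamma> \<prec> \<alpha> \<Longrightarrow> lpt (C \<alpha>) \<gamma> \<Longrightarrow> \<gamma> \<in> C \<alpha> \<and> C \<gamma> = C \<alpha> \<inter> underS r \<gamma>"
    by (auto simp: coherent_ladder_def)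
  show "fill_gaps G (C \<alpha>) \<subseteq> underS r \<alpha>"
    using C(1) lt_trans unfolding fill_gaps_def consecutive_def by fastforce
  show "lpt (fill_gaps G (C \<alpha>)) \<alpha>"
    using C(2) by (rule lpt_mono) (simp add: fill_gaps_def)
  fix \<gamma> assume \<gamma>: "\<gamma> \<prec> \<alpha>" "lpt (fill_gaps G (C \<alpha>)) \<gamma>"
  then have "lpt (C \<alpha>) \<gamma>"
    using lpt_fill_gaps assms(2) unfolding consecutive_def by blast
  with C(3) \<gamma> have \<gamma>': "\<gamma> \<in> C \<alpha>" "C \<gamma> = C \<alpha> \<inter> underS r \<gamma>" by blast+
  then show "\<gamma> \<in> fill_gaps G (C \<alpha>)" by (simp add: fill_gaps_def)
  show "fill_gaps G (C \<gamma>) = fill_gaps G (C \<alpha>) \<inter> underS r \<gamma>"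
    unfolding \<gamma>'(2) using fill_gaps_Int \<open>lpt (C \<alpha>) \<gamma>\<close> \<gamma>'(1) by blast
qed

section \<open>A ladder guessing clubs, from the square principle\<close>

lemma nacc_iff: "x \<in> nacc r X \<longleftrightarrow> x \<in> X \<and> \<not> lpt X x"
  by (auto simp: nacc_def acc_eq)

lemma not_lptE:
  assumes "\<not> lpt X \<alpha>" "e \<prec> \<alpha>"
  obtains d where "d \<prec> \<alpha>" "\<And>x. x \<in> X \<Longrightarrow> x \<prec> \<alpha> \<Longrightarrow> \<not> d \<prec> x"
  using assms unfolding lpt_def onz_def by blast

text \<open>Well-founded induction on the value at the least element of \<open>J\<close>. The next
  element of \<open>J\<close> either repeats that value or has a smaller one, in which case the
  least element is dropped from \<open>J\<close>.\<close>

lemma antitone_repeats: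
  assumes "infinite I" "I \<subseteq> K" "\<And>i. i \<in> I \<Longrightarrow> v i \<in> K"
    and "\<And>i j. i \<in> I \<Longrightarrow> j \<in> I \<Longrightarrow> i \<prec> j \<Longrightarrow> \<not> v i \<prec> v j"
  shows "\<exists>i\<in>I. \<exists>j\<in>I. i \<prec> j \<and> v i = v j"
proof -
  have "\<exists>i\<in>I. \<exists>j\<in>I. i \<prec> j \<and> v i = v j"
    if "J \<subseteq> I" "infinite J" "k \<in> J" "\<And>x. x \<in> J \<Longrightarrow> \<not> x \<prec> k" "v k = g" for J k g
    using that
  proof (induction g arbitrary: J k rule: wf_induct_rule[OF wf_lt])
    case (1 g)
    note J = 1(2-6)
    have "infinite (J - {k})" using J(2) by simp
    then have "J - {k} \<noteq> {}" by (metis finite.emptyI)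
    moreover have "J - {k} \<subseteq> K" using J(1) assms(2) by blast
    ultimately obtain l where l: "l \<in> J - {k}" "\<And>x. x \<in> J - {k} \<Longrightarrow> \<not> x \<prec> l"
      using ex_least[of "J - {k}"] by blast
    have "k \<prec> l" "k \<in> I" "l \<in> I"
      using J(1,3,4) l(1) lt_linear[of k l] assms(2) by blast+
    show ?case
    proof (cases "v k = v l")
      case True
      then show ?thesis using \<open>k \<prec> l\<close> \<open>k \<in> I\<close> \<open>l \<in> I\<close> by blast
    next
      case False
      then have "v l \<prec> g"
        using lt_linear assms(3,4) \<open>k \<prec> l\<close> \<open>k \<in> I\<close> \<open>l \<in> I\<close> J(5) by blast
      then have "(v l, g) \<in> {(a, b). a \<prec> b}" by simp
      from 1(1)[OF this _ \<open>infinite (J - {k})\<close> l refl] 1(2) show ?thesis by blast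
    qed
  qed
  moreover obtain k where "k \<in> I" "\<And>x. x \<in> I \<Longrightarrow> \<not> x \<prec> k"
    using ex_least[of I] assms(1,2) by (metis finite.emptyI)
  ultimately show ?thesis using assms(1) by blast
qed

text \<open>This works for any cofinality of \<open>\<alpha>\<close>: if every proper initial segment captured only
  finitely many values, then the values on a countably infinite subset of \<open>X\<close> would be cofinal,
  making \<open>X\<close> a countable union of finite sets.\<close>

lemma ex_bound_infinitely_often:
  assumes "uncountable X" "\<And>i. i \<in> X \<Longrightarrow> t i \<prec> \<alpha>"
  shows "\<exists>\<tau>. \<tau> \<prec> \<alpha> \<and> infinite {i \<in> X. \<not> \<tau> \<prec> t i}"
proof (rule ccontr)
  assume "\<not> ?thesis"
  then have fin: "finite {i \<in> X. \<not> \<tau> \<prec> t i}" if "\<tau> \<prec> \<alpha>" for \<tau>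
    using that by blast
  obtain J where J: "J \<subseteq> X" "countable J" "infinite J"
    using infinite_countable_subset'[OF uncountable_infinite[OF assms(1)]] by blast
  have "X \<subseteq> (\<Union>j\<in>J. {i \<in> X. \<not> t j \<prec> t i})"
  proof
    fix i assume "i \<in> X"
    have "\<not> J \<subseteq> {j \<in> X. \<not> t i \<prec> t j}"
      using fin[of "t i"] assms(2) \<open>i \<in> X\<close> J(3) finite_subset by blast
    then obtain j where "j \<in> J" "t i \<prec> t j" using J(1) by blast
    then have "\<not> t j \<prec> t i" using lt_trans lt_irrefl by blast
    with \<open>j \<in> J\<close> \<open>i \<in> X\<close> show "i \<in> (\<Union>j\<in>J. {i \<in> X. \<not> t j \<prec> t i})" by blast
  qed
  moreover have "countable (\<Union>j\<in>J. {i \<in> X. \<not> t j \<prec> t i})"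
  proof (rule countable_UN[OF J(2)])
    show "countable {i \<in> X. \<not> t j \<prec> t i}" if "j \<in> J" for j
      using fin assms(2) J(1) that by (blast intro: countable_finite)
  qed
  ultimately show False
    using assms(1) countable_subset by blast
qed

text \<open>Any two points of \<open>D\<close> above \<tau> are limit points of a common
  \<open>C \<alpha>\<close>, so by coherence the sets \<open>C \<delta>\<close> at such points
  end-extend one another. Their union \<open>E\<close> is the thread.\<close>

lemma ladder_thread:
  assumes C: "coherent_ladder C" and D: "club r D" and "\<tau> \<in> K"
    and acc: "\<And>b. b \<in> K \<Longrightarrow>
      \<exists>\<alpha>. b \<prec> \<alpha> \<and> lpt K \<alpha> \<and> (\<forall>\<delta>\<in>D. \<tau> \<prec> \<delta> \<longrightarrow> \<delta> \<prec> \<alpha> \<longrightarrow> lpt (C \<alpha>) \<delta>)"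
  shows "\<exists>E. club r E \<and> (\<forall>\<alpha>\<in>acc r E. E \<inter> underS r \<alpha> = C \<alpha>)"
proof -
  let ?D = "{\<delta> \<in> D. \<tau> \<prec> \<delta>}"
  define E where "E = (\<Union>\<delta>\<in>?D. C \<delta>)"
  have lim: "lpt K \<delta>" if "\<delta> \<in> ?D" for \<delta>
    using acc[of \<delta>] that lt_Field lpt_K by blast
  have ladder: "C \<alpha> \<subseteq> underS r \<alpha>" "lpt (C \<alpha>) \<alpha>"
    "\<And>\<gamma>. \<gamma> \<prec> \<alpha> \<Longrightarrow> lpt (C \<alpha>) \<gamma> \<Longrightarrow> \<gamma> \<in> C \<alpha> \<and> C \<gamma> = C \<alpha> \<inter> underS r \<gamma>" if "lpt K \<alpha>" for \<alpha>
    using C that by (auto simp: coherent_ladder_def)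
  have initial: "C \<delta> = C \<delta>' \<inter> underS r \<delta>" if \<delta>: "\<delta> \<in> ?D" "\<delta>' \<in> ?D" "\<delta> \<prec> \<delta>'" for \<delta> \<delta>'
  proof -
    have "\<delta>' \<in> K" using \<delta>(3) lt_Field by blast
    then obtain \<alpha> where \<alpha>: "\<delta>' \<prec> \<alpha>" "lpt K \<alpha>" "\<forall>\<delta>\<in>D. \<tau> \<prec> \<delta> \<longrightarrow> \<delta> \<prec> \<alpha> \<longrightarrow> lpt (C \<alpha>) \<delta>"
      using acc by blast
    have "\<delta> \<prec> \<alpha>" using \<alpha>(1) \<delta>(3) lt_trans by blast
    then have "C \<delta> = C \<alpha> \<inter> underS r \<delta>" "C \<delta>' = C \<alpha> \<inter> underS r \<delta>'"
      using ladder(3)[OF \<alpha>(2)] \<alpha>(1,3) \<delta> by blast+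
    moreover have "x \<prec> \<delta>'" if "x \<prec> \<delta>" for x
      using that \<delta>(3) by (rule lt_trans)
    then have "underS r \<delta> \<subseteq> underS r \<delta>'"
      by auto
    ultimately show ?thesis by blast
  qed
  have E_Int: "E \<inter> underS r \<delta> = C \<delta>" if \<delta>: "\<delta> \<in> ?D" for \<delta>
  proof
    show "E \<inter> underS r \<delta> \<subseteq> C \<delta>"
    proof
      fix x assume "x \<in> E \<inter> underS r \<delta>"
      then obtain \<delta>' where \<delta>': "\<delta>' \<in> ?D" "x \<in> C \<delta>'" "x \<prec> \<delta>" by (auto simp: E_def)
      consider "\<delta> \<prec> \<delta>'" | "\<delta> = \<delta>'" | "\<delta>' \<prec> \<delta>"
        using lt_linear \<delta> \<delta>'(1) lt_Field by blast
      then show "x \<in> C \<delta>"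
      proof cases
        case 1
        with initial[OF \<delta> \<delta>'(1)] \<delta>'(2,3) show ?thesis by simp
      next
        case 2
        with \<delta>'(2) show ?thesis by simp
      next
        case 3
        with initial[OF \<delta>'(1) \<delta>] \<delta>'(2) show ?thesis by simp
      qed
    qed
    show "C \<delta> \<subseteq> E \<inter> underS r \<delta>"
      using \<delta> ladder(1)[OF lim[OF \<delta>]] unfolding E_def by blast
  qed
  have D_above: "\<exists>\<delta>\<in>?D. b \<prec> \<delta>" if b: "b \<in> K" for b
  proof -
    obtain c where "b \<prec> c" "\<tau> \<prec> c" using ex_greater b \<open>\<tau> \<in> K\<close> by blast
    moreover obtain \<delta> where "\<delta> \<in> D" "c \<prec> \<delta>"
      using D calculation lt_Field unfolding club_iff by blast
    ultimately show ?thesis using lt_trans by blast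
  qed
  have E_lpt: "\<alpha> \<in> E \<and> E \<inter> underS r \<alpha> = C \<alpha>" if \<alpha>: "lpt E \<alpha>" for \<alpha>
  proof -
    obtain \<delta> where \<delta>: "\<delta> \<in> ?D" "\<alpha> \<prec> \<delta>" using D_above[OF lpt_Field[OF \<alpha>]] by blast
    have "lpt (C \<delta>) \<alpha>"
      using \<alpha>
    proof (rule lpt_mono)
      fix x assume "x \<in> E" "x \<prec> \<alpha>"
      then have "x \<prec> \<delta>" using \<delta>(2) lt_trans by blast
      with \<open>x \<in> E\<close> have "x \<in> E \<inter> underS r \<delta>" by simp
      then show "x \<in> C \<delta>" unfolding E_Int[OF \<delta>(1)] .
    qed
    from ladder(3)[OF lim[OF \<delta>(1)] \<delta>(2) this]
    have "\<alpha> \<in> C \<delta>" "C \<alpha> = C \<delta> \<inter> underS r \<alpha>"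
      by simp_all
    moreover have "x \<prec> \<delta>" if "x \<prec> \<alpha>" for x
      using that \<delta>(2) by (rule lt_trans)
    then have "underS r \<alpha> \<subseteq> underS r \<delta>"
      by auto
    moreover note E_Int[OF \<delta>(1)]
    ultimately show ?thesis by blast
  qed
  have "club r E"
    unfolding club_iff
  proof (intro conjI ballI allI impI)
    show "E \<subseteq> K" using ladder(1) lim lt_Field unfolding E_def by fastforce
    fix b assume "b \<in> K"
    then obtain \<delta> where \<delta>: "\<delta> \<in> ?D" "b \<prec> \<delta>" using D_above by blast
    with ladder(2)[OF lim] obtain x where "x \<in> C \<delta>" "b \<prec> x" by (blast elim: lptE)
    with \<delta> show "\<exists>\<gamma>\<in>E. b \<prec> \<gamma>" unfolding E_def by blast
  qed (use E_lpt in blast)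
  with E_lpt show ?thesis unfolding acc_eq by blast
qed

text \<open>The core of the club guessing argument. \<open>E i\<close> stands for the club that the
  projection along \<open>D i\<close> fails to guess, and \<tau> bounds, below \<alpha>, the
  non-accumulation points of the projections that lie in \<open>E i\<close>. The conclusion comes
  from showing that a repeated projection of a single point of \<open>C \<alpha>\<close> equals
  \<delta>.\<close>

lemma lpt_ladder_of_stable:
  assumes C: "coherent_ladder C" and "lpt K \<alpha>" and I: "infinite I" "I \<subseteq> K"
    and D: "\<And>i. i \<in> I \<Longrightarrow> club r (D i)" "\<And>i. i \<in> I \<Longrightarrow> lpt (D i) \<alpha>"
    and anti: "\<And>i j. i \<in> I \<Longrightarrow> j \<in> I \<Longrightarrow> i \<prec> j \<Longrightarrow> D j \<subseteq> D i \<inter> E i"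
    and \<tau>: "\<And>i x. i \<in> I \<Longrightarrow> x \<in> nacc r (club_project (D i) C \<alpha>) \<Longrightarrow> x \<in> E i \<Longrightarrow> x \<prec> \<alpha> \<Longrightarrow> \<not> \<tau> \<prec> x"
    and \<delta>: "\<And>i. i \<in> I \<Longrightarrow> \<delta> \<in> D i" "\<tau> \<prec> \<delta>" "\<delta> \<prec> \<alpha>"
  shows "lpt (C \<alpha>) \<delta>"
proof -
  have ladder: "C \<alpha> \<subseteq> underS r \<alpha>" "lpt (C \<alpha>) \<alpha>"
    "\<And>\<gamma>. \<gamma> \<prec> \<alpha> \<Longrightarrow> lpt (C \<alpha>) \<gamma> \<Longrightarrow> \<gamma> \<in> C \<alpha>"
    using C \<open>lpt K \<alpha>\<close> by (auto simp: coherent_ladder_def)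
  let ?U = "{\<eta> \<in> C \<alpha>. \<delta> \<prec> \<eta>}"
  have "?U \<noteq> {}" "?U \<subseteq> K"
    using lptE[OF ladder(2) \<delta>(3)] lt_Field by blast+
  \<comment> \<open>The point to be projected along all \<open>D i\<close> is the least element of
    \<open>C \<alpha>\<close> above \<delta>. Each \<open>D i\<close> contains \<delta>, so every
    projection \<open>v i\<close> exists and is at least \<delta>.\<close>
  then obtain \<beta> where \<beta>: "\<beta> \<in> ?U" "\<And>\<eta>. \<eta> \<in> ?U \<Longrightarrow> \<not> \<eta> \<prec> \<beta>"
    using ex_least[of ?U] by blast
  have "\<exists>\<gamma>. sup_upto (D i) \<beta> \<gamma>" if "i \<in> I" for i
    using ex_sup_upto[OF D(1)[OF that] \<delta>(1)[OF that], of \<beta>] \<beta>(1) by blast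
  then obtain v where v: "\<And>i. i \<in> I \<Longrightarrow> sup_upto (D i) \<beta> (v i)" by metis
  have vD: "v i \<in> D i" if "i \<in> I" for i
    using v[OF that] by (simp add: sup_upto_def)
  have "\<not> v i \<prec> v j" if "i \<in> I" "j \<in> I" "i \<prec> j" for i j
  proof (cases "v j \<prec> \<beta>")
    case True
    have "v j \<in> D i" using anti vD that by blast
    with True v[OF that(1)] show ?thesis using sup_upto_not_less by blast
  next
    case False
    then have "v j = \<beta>" "lpt (D j) \<beta>"
      using v[OF that(2)] by (auto simp: sup_upto_def)
    then have "lpt (D i) \<beta>" using anti[OF that] by (blast intro: lpt_mono)
    then show ?thesis
      using v[OF that(1)] \<open>v j = \<beta>\<close> by (auto simp: sup_upto_def elim: lptE)
  qed
  moreover have "v i \<in> K" if "i \<in> I" for i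
    using vD D(1) that unfolding club_iff by blast
  ultimately obtain i j where ij: "i \<in> I" "j \<in> I" "i \<prec> j" "v i = v j"
    using antitone_repeats[OF I] by blast
  \<comment> \<open>The repetition is used here: \<open>v i = v j\<close> lies in
    \<open>D j\<close>, which is contained in \<open>E i\<close>. Being above \<tau>, it must then
    be an accumulation point of the projection.\<close>
  have "v i \<in> E i" using anti vD ij by force
  have "\<not> v i \<prec> \<delta>"
    using sup_upto_not_less[OF v[OF ij(1)] \<delta>(1)[OF ij(1)]] \<beta>(1) by blast
  then have "\<tau> \<prec> v i"
    using \<delta>(2) \<open>v i \<in> E i\<close> ij(1) vD D(1) lt_le_trans unfolding club_iff by blast
  have "v i \<in> club_project (D i) C \<alpha>"
    using v[OF ij(1)] D(2)[OF ij(1)] \<beta>(1) by (auto simp: club_project_def)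
  moreover from this have "v i \<prec> \<alpha>"
    using club_project_subset[where C = C and \<alpha> = \<alpha> and D = "D i", OF ladder(1)] by auto
  ultimately have "lpt (club_project (D i) C \<alpha>) (v i)"
    using \<tau>[OF ij(1)] \<open>v i \<in> E i\<close> \<open>\<tau> \<prec> v i\<close> by (auto simp: nacc_iff)
  then have lpt: "lpt (C \<alpha>) (v i)" by (rule lpt_club_project)
  then have "v i \<in> C \<alpha>" using ladder(3) \<open>v i \<prec> \<alpha>\<close> by blast
  \<comment> \<open>\<beta> is no limit of \<open>C \<alpha>\<close>, since
    \<open>C \<alpha>\<close> has no points strictly between \<delta> and \<beta>. So
    \<open>v i\<close>, a point of \<open>C \<alpha>\<close> below \<beta>, is at most
    \<delta>.\<close>
  have "v i \<noteq> \<beta>"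
  proof
    assume "v i = \<beta>"
    with lpt obtain x where "x \<in> C \<alpha>" "\<delta> \<prec> x" "x \<prec> \<beta>" using \<beta>(1) by (auto elim: lptE)
    with \<beta>(2) show False by blast
  qed
  then have "v i \<prec> \<beta>" using v[OF ij(1)] by (auto simp: sup_upto_def)
  then have "\<not> \<delta> \<prec> v i" using \<beta>(2) \<open>v i \<in> C \<alpha>\<close> by blast
  with \<open>\<not> v i \<prec> \<delta>\<close> have "v i = \<delta>"
    using lt_linear \<open>\<tau> \<prec> v i\<close> \<delta>(2) lt_Field by blast
  with lpt show ?thesis by simp
qed

text \<open>Well-founded recursion intersecting all earlier \<open>D j\<close> and
  \<open>G (D j)\<close>; there are fewer than \<kappa> of them, so clubs survive at every
  stage.\<close>

lemma decreasing_clubs: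
  assumes G: "\<And>D. club r D \<Longrightarrow> club r (G D)"
  obtains D where "\<And>i. i \<in> K \<Longrightarrow> club r (D i)" "\<And>i j. i \<prec> j \<Longrightarrow> D j \<subseteq> D i \<inter> G (D i)"
proof -
  let ?R = "{(a, b). a \<prec> b}"
  let ?H = "\<lambda>f i. K \<inter> (\<Inter>j\<in>underS r i. f j \<inter> G (f j))"
  define D where "D = wfrec ?R ?H"
  have D: "D i = ?H D i" for i
    unfolding D_def by (subst wfrec[OF wf_lt]) (auto simp: cut_apply)
  have "i \<in> K \<longrightarrow> club r (D i)" for i
  proof (induction i rule: wf_induct_rule[OF wf_lt])
    case (1 i)
    show ?case
    proof
      assume "i \<in> K"
      then show "club r (D i)"
        unfolding D[of i]
        by (rule club_INT) (use 1 lt_Field G club_Int in blast)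
    qed
  qed
  moreover have "D j \<subseteq> D i \<inter> G (D i)" if "i \<prec> j" for i j
    using that unfolding D[of j] by auto
  ultimately show thesis using that by blast
qed

lemma ex_guessing_ladder:
  assumes "square r" "stationary r S" "\<theta> \<in> K" "uncountable (underS r \<theta>)"
  shows "\<exists>C. coherent_ladder C \<and> (\<forall>E. club r E \<longrightarrow> (\<exists>\<alpha>\<in>S. lpt (nacc r (C \<alpha>) \<inter> E) \<alpha>))"
proof (rule ccontr)
  assume "\<not> ?thesis"
  then have no: "\<exists>E. club r E \<and> (\<forall>\<alpha>\<in>S. \<not> lpt (nacc r (C \<alpha>) \<inter> E) \<alpha>)"
    if "coherent_ladder C" for C
    using that by blast
  obtain C where "C_sequence r C" "coherent r C"
    and no_thread: "\<not> (\<exists>D. club r D \<and> (\<forall>\<alpha>\<in>acc r D. D \<inter> underS r \<alpha> = C \<alpha>))"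
    using assms(1) unfolding square_def by blast
  then have C: "coherent_ladder C" using C_sequence_ladder by blast
  have "\<exists>E. club r E \<and> (\<forall>\<alpha>\<in>S. \<not> lpt (nacc r (club_project D C \<alpha>) \<inter> E) \<alpha>)" if "club r D" for D
    using no coherent_ladder_project[OF that C] by blast
  \<comment> \<open>\<open>G D\<close> is a club that the projection of \<open>C\<close> along
    \<open>D\<close> fails to guess at every point of \<open>S\<close>.\<close>
  then obtain G where G: "\<And>D. club r D \<Longrightarrow> club r (G D)"
    "\<And>D \<alpha>. club r D \<Longrightarrow> \<alpha> \<in> S \<Longrightarrow> \<not> lpt (nacc r (club_project D C \<alpha>) \<inter> G D) \<alpha>"
    by metis
  obtain D where D: "\<And>i. i \<in> K \<Longrightarrow> club r (D i)" "\<And>i j. i \<prec> j \<Longrightarrow> D j \<subseteq> D i \<inter> G (D i)"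
    using decreasing_clubs[of G] G(1) by blast
  have "\<exists>t. t \<prec> \<alpha> \<and> (\<forall>\<delta>\<in>D \<theta>. t \<prec> \<delta> \<longrightarrow> \<delta> \<prec> \<alpha> \<longrightarrow> lpt (C \<alpha>) \<delta>)"
    if \<alpha>: "\<alpha> \<in> S" "lpt (D \<theta>) \<alpha>" for \<alpha>
  proof -
    obtain z where "z \<prec> \<alpha>" using \<alpha>(2) by (auto simp: lpt_def onz_def)
    have "\<exists>t. t \<prec> \<alpha> \<and> (\<forall>x\<in>nacc r (club_project (D i) C \<alpha>) \<inter> G (D i). x \<prec> \<alpha> \<longrightarrow> \<not> t \<prec> x)"
      if "i \<prec> \<theta>" for i
      using not_lptE[OF G(2)[OF D(1) \<alpha>(1)] \<open>z \<prec> \<alpha>\<close>] that lt_Field by metis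
    then obtain t where t: "\<And>i. i \<prec> \<theta> \<Longrightarrow> t i \<prec> \<alpha>" "\<And>i x. i \<prec> \<theta> \<Longrightarrow>
        x \<in> nacc r (club_project (D i) C \<alpha>) \<inter> G (D i) \<Longrightarrow> x \<prec> \<alpha> \<Longrightarrow> \<not> t i \<prec> x"
      by metis
    \<comment> \<open>The bound \<open>t i\<close> depends on the stage. Uncountably many stages
      allow infinitely many of them to share one bound \<tau> below \<alpha>, and infinitely many
      are enough for a repeated projection.\<close>
    obtain \<tau> where \<tau>: "\<tau> \<prec> \<alpha>" "infinite {i \<in> underS r \<theta>. \<not> \<tau> \<prec> t i}" (is "infinite ?I")
      using ex_bound_infinitely_often[OF assms(4), of t \<alpha>] t(1) by auto
    have "lpt (C \<alpha>) \<delta>" if \<delta>: "\<delta> \<in> D \<theta>" "\<tau> \<prec> \<delta>" "\<delta> \<prec> \<alpha>" for \<delta>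
    proof (rule lpt_ladder_of_stable[OF C lpt_K[OF \<alpha>(2)] \<tau>(2)])
      show "?I \<subseteq> K" using lt_Field by auto
      show "club r (D i)" if "i \<in> ?I" for i using that D(1) lt_Field by auto
      show "lpt (D i) \<alpha>" if "i \<in> ?I" for i
        using \<alpha>(2) by (rule lpt_mono) (use that D(2)[of i \<theta>] in auto)
      show "D j \<subseteq> D i \<inter> G (D i)" if "i \<prec> j" for i j using that by (rule D(2))
      show "\<not> \<tau> \<prec> x" if "i \<in> ?I" "x \<in> nacc r (club_project (D i) C \<alpha>)" "x \<in> G (D i)" "x \<prec> \<alpha>" for i x
        using that t(2)[of i x] t(1)[of i] \<tau>(1) lt_Field lt_trans lt_linear
        by (metis (no_types, lifting) IntI mem_Collect_eq mem_underS)
      show "\<delta> \<in> D i" if "i \<in> ?I" for i using that D(2)[of i \<theta>] \<delta>(1) by auto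
    qed (use \<delta> in auto)
    with \<tau>(1) show ?thesis by blast
  qed
  then obtain t where t: "\<And>\<alpha>. \<alpha> \<in> S \<Longrightarrow> lpt (D \<theta>) \<alpha> \<Longrightarrow> t \<alpha> \<prec> \<alpha>"
    "\<And>\<alpha> \<delta>. \<alpha> \<in> S \<Longrightarrow> lpt (D \<theta>) \<alpha> \<Longrightarrow> \<delta> \<in> D \<theta> \<Longrightarrow> t \<alpha> \<prec> \<delta> \<Longrightarrow> \<delta> \<prec> \<alpha> \<Longrightarrow> lpt (C \<alpha>) \<delta>"
    by metis
  \<comment> \<open>Pressing down replaces the bounds \<open>t \<alpha>\<close> by one \<tau> valid
    for unboundedly many \<alpha>, as the thread construction requires.\<close>
  obtain \<tau> where \<tau>: "\<tau> \<in> K" "\<And>b. b \<in> K \<Longrightarrow> \<exists>\<alpha>\<in>S. b \<prec> \<alpha> \<and> lpt (D \<theta>) \<alpha> \<and> \<not> \<tau> \<prec> t \<alpha>"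
    using regressive_on_stationary[OF assms(2) D(1)[OF assms(3)] t(1)] by blast
  have "\<exists>\<alpha>. b \<prec> \<alpha> \<and> lpt K \<alpha> \<and> (\<forall>\<delta>\<in>D \<theta>. \<tau> \<prec> \<delta> \<longrightarrow> \<delta> \<prec> \<alpha> \<longrightarrow> lpt (C \<alpha>) \<delta>)" if b: "b \<in> K" for b
  proof -
    obtain \<alpha> where \<alpha>: "\<alpha> \<in> S" "b \<prec> \<alpha>" "lpt (D \<theta>) \<alpha>" "\<not> \<tau> \<prec> t \<alpha>" using \<tau>(2)[OF b] by blast
    have "t \<alpha> \<prec> \<delta>" if "\<tau> \<prec> \<delta>" for \<delta>
      using that \<alpha> t(1) le_lt_trans lt_Field by blast
    with \<alpha> t(2) lpt_K show ?thesis by blast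
  qed
  with ladder_thread[OF C D(1)[OF assms(3)] \<tau>(1)] no_thread show False by blast
qed

section \<open>Consequences of membership in \<open>J_omega\<close>\<close>

lemma J_omegaD:
  assumes "S \<in> J_omega r"
  shows "\<exists>Cl F. club r Cl \<and> (\<forall>i\<in>K. \<forall>\<beta>\<in>K. finite (F i \<beta>)) \<and>
      (\<forall>\<alpha>\<in>S \<inter> Cl. \<forall>f B. (\<forall>\<beta>. \<beta> \<prec> \<alpha> \<longrightarrow> f \<beta> \<prec> \<alpha> \<and> (onz r \<beta> \<longrightarrow> f \<beta> \<prec> \<beta>)) \<and>
        B \<subseteq> underS r \<alpha> \<and> lpt B \<alpha> \<longrightarrow> (\<exists>i. i \<prec> \<alpha> \<and> lpt {\<beta> \<in> B. f \<beta> \<in> F i \<beta>} \<alpha>))"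
proof -
  obtain Cl F where Cl: "club r Cl"
    and F: "\<forall>i\<in>K. \<forall>\<beta>\<in>K. finite (F i \<beta>) \<and> F i \<beta> \<subseteq> K"
    and J: "\<forall>\<alpha>\<in>S \<inter> Cl. \<forall>f B.
      (\<forall>\<beta>\<in>underS r \<alpha>. f \<beta> \<in> underS r \<alpha> \<and> (onz r \<beta> \<longrightarrow> f \<beta> \<prec> \<beta>)) \<and>
        B \<subseteq> underS r \<alpha> \<and> is_sup r B \<alpha> \<longrightarrow>
      (\<exists>i\<in>underS r \<alpha>. is_sup r {\<beta>\<in>B. f \<beta> \<in> F i \<beta>} \<alpha>)"
    using assms unfolding J_omega_def mem_Collect_eq by (elim conjE exE) (rule that)
  have "\<exists>i. i \<prec> \<alpha> \<and> lpt {\<beta> \<in> B. f \<beta> \<in> F i \<beta>} \<alpha>"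
    if \<alpha>: "\<alpha> \<in> S \<inter> Cl"
      and f: "\<forall>\<beta>. \<beta> \<prec> \<alpha> \<longrightarrow> f \<beta> \<prec> \<alpha> \<and> (onz r \<beta> \<longrightarrow> f \<beta> \<prec> \<beta>)"
      and B: "B \<subseteq> underS r \<alpha>" "lpt B \<alpha>" for \<alpha> f B
  proof -
    have is_sup: "is_sup r X \<alpha> \<longleftrightarrow> lpt X \<alpha>" if "X \<subseteq> B" for X
      using that B lpt_onz by (intro is_sup_iff) auto
    have "\<forall>\<beta>\<in>underS r \<alpha>. f \<beta> \<in> underS r \<alpha> \<and> (onz r \<beta> \<longrightarrow> f \<beta> \<prec> \<beta>)"
      using f by simp
    moreover have "is_sup r B \<alpha>" using B(2) is_sup by simp
    ultimately have "\<exists>i\<in>underS r \<alpha>. is_sup r {\<beta>\<in>B. f \<beta> \<in> F i \<beta>} \<alpha>"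
      using J \<alpha> B(1) by simp
    moreover have "{\<beta>\<in>B. f \<beta> \<in> F i \<beta>} \<subseteq> B" for i by blast
    ultimately show ?thesis using is_sup by auto
  qed
  with Cl F show ?thesis by (intro exI[of _ Cl] exI[of _ F]) simp
qed

text \<open>If \<open>\<alpha>\<close> is countable, a regressive \<open>f\<close> can avoid the finitely many finite sets
  \<open>F i \<beta>\<close> whose index \<open>i\<close> precedes \<open>\<beta>\<close> in an enumeration of \<open>\<alpha>\<close> in order type \<open>\<omega>\<close>.\<close>

lemma J_omega_uncountable_segment:
  assumes "stationary r S" "S \<in> J_omega r"
  obtains \<theta> where "\<theta> \<in> K" "uncountable (underS r \<theta>)"
proof (rule ccontr)
  assume "\<not> thesis"
  with that have count: "countable (underS r \<theta>)" if "\<theta> \<in> K" for \<theta> using that by blast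
  obtain Cl F where Cl: "club r Cl" and F: "\<forall>i\<in>K. \<forall>\<beta>\<in>K. finite (F i \<beta>)"
    and J: "\<forall>\<alpha>\<in>S \<inter> Cl. \<forall>f B. (\<forall>\<beta>. \<beta> \<prec> \<alpha> \<longrightarrow> f \<beta> \<prec> \<alpha> \<and> (onz r \<beta> \<longrightarrow> f \<beta> \<prec> \<beta>)) \<and>
        B \<subseteq> underS r \<alpha> \<and> lpt B \<alpha> \<longrightarrow> (\<exists>i. i \<prec> \<alpha> \<and> lpt {\<beta> \<in> B. f \<beta> \<in> F i \<beta>} \<alpha>)"
    using J_omegaD[OF assms(2)] by (elim exE conjE) (rule that)
  have "infinite K"
    using unc finite_imp_inj_to_nat_seg unfolding uncountable_set_def by metis
  then obtain N where N: "N \<subseteq> K" "countable N" "infinite N"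
    using infinite_countable_subset' by blast
  \<comment> \<open>Every ordinal above \<open>w\<close> has infinitely many predecessors, leaving a
    regressive value outside any finite set.\<close>
  obtain w where w: "w \<in> K" "\<And>x. x \<in> N \<Longrightarrow> x \<prec> w"
    using ex_upper_bound[OF N(1) countable_ordLess[OF N(2)]] by blast
  have inf: "infinite (underS r b)" if "w \<prec> b" for b
  proof -
    have "N \<subseteq> underS r b" using w(2) that lt_trans unfolding subset_eq mem_underS by blast
    with N(3) show ?thesis using finite_subset by blast
  qed
  \<comment> \<open>A nonzero ordinal closed under the constant function \<open>w\<close> is one
    above \<open>w\<close>.\<close>
  define Cw where "Cw = {\<beta>. closed_under (\<lambda>_. w) \<beta>}"
  have "club r (Cl \<inter> Cw)"
    unfolding Cw_def by (intro club_Int Cl club_closed_under w(1))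
  then obtain \<alpha> where \<alpha>: "\<alpha> \<in> S" "lpt (Cl \<inter> Cw) \<alpha>" "\<alpha> \<in> Cl" "\<alpha> \<in> Cw"
    using stationaryE[OF assms(1)] by blast
  then have lim: "lpt K \<alpha>" and "\<alpha> \<in> K" using lpt_K lpt_Field by blast+
  have "w \<prec> \<alpha>" using \<alpha>(4) by (auto simp: Cw_def closed_under_def onz_def)
  obtain idx :: "'a \<Rightarrow> nat" where idx: "inj_on idx (underS r \<alpha>)"
    using count[OF \<open>\<alpha> \<in> K\<close>] unfolding countable_def by blast
  have fin: "finite {i. i \<prec> \<alpha> \<and> idx i \<le> n}" for n
    using finite_vimage_IntI[OF finite_atMost[of n] idx] by (auto elim!: rev_finite_subset)
  have "\<exists>y. y \<prec> \<alpha> \<and> (onz r \<beta> \<longrightarrow> y \<prec> \<beta>) \<and>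
      (w \<prec> \<beta> \<longrightarrow> (\<forall>i. i \<prec> \<alpha> \<longrightarrow> idx i \<le> idx \<beta> \<longrightarrow> y \<notin> F i \<beta>))" if \<beta>: "\<beta> \<prec> \<alpha>" for \<beta>
  proof (cases "w \<prec> \<beta>")
    case True
    let ?U = "\<Union>i\<in>{i. i \<prec> \<alpha> \<and> idx i \<le> idx \<beta>}. F i \<beta>"
    have "finite ?U" using F fin \<beta> lt_Field by (intro finite_UN_I) auto
    then have "infinite (underS r \<beta> - ?U)"
      using inf[OF True] by (rule Diff_infinite_finite)
    then obtain y where "y \<in> underS r \<beta> - ?U"
      by (metis finite.emptyI ex_in_conv)
    then have y: "y \<prec> \<beta>" "\<And>i. i \<prec> \<alpha> \<Longrightarrow> idx i \<le> idx \<beta> \<Longrightarrow> y \<notin> F i \<beta>"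
      by auto
    moreover have "y \<prec> \<alpha>" using y(1) \<beta> by (rule lt_trans)
    ultimately show ?thesis by blast
  next
    case False
    then show ?thesis using \<beta> lt_trans unfolding onz_def by blast
  qed
  then obtain f where f: "\<And>\<beta>. \<beta> \<prec> \<alpha> \<Longrightarrow> f \<beta> \<prec> \<alpha>" "\<And>\<beta>. \<beta> \<prec> \<alpha> \<Longrightarrow> onz r \<beta> \<Longrightarrow> f \<beta> \<prec> \<beta>"
    "\<And>\<beta> i. \<beta> \<prec> \<alpha> \<Longrightarrow> w \<prec> \<beta> \<Longrightarrow> i \<prec> \<alpha> \<Longrightarrow> idx i \<le> idx \<beta> \<Longrightarrow> f \<beta> \<notin> F i \<beta>"
    by metis
  let ?B = "{\<beta>. \<beta> \<prec> \<alpha> \<and> w \<prec> \<beta>}"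
  have "lpt ?B \<alpha>"
    unfolding lpt_def using lptE2[OF lim _ \<open>w \<prec> \<alpha>\<close>] lpt_onz[OF lim] by blast
  moreover have "?B \<subseteq> underS r \<alpha>" by auto
  ultimately obtain i where i: "i \<prec> \<alpha>" "lpt {\<beta> \<in> ?B. f \<beta> \<in> F i \<beta>} \<alpha>" (is "lpt ?Bi \<alpha>")
    using J[rule_format, of \<alpha> f ?B] \<alpha>(1,3) f(1,2) by blast
  have "infinite ?Bi"
    using lpt_infinite[OF i(2) \<open>w \<prec> \<alpha>\<close>] by (rule contrapos_nn) (erule rev_finite_subset, blast)
  \<comment> \<open>A \<beta> with \<open>f \<beta>\<close> in \<open>F i \<beta>\<close> must be
    enumerated before \<open>i\<close>, which leaves only finitely many.\<close>
  moreover have "?Bi \<subseteq> {\<beta>. \<beta> \<prec> \<alpha> \<and> idx \<beta> \<le> idx i}"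
    using f(3) i(1) by (auto simp: not_less[symmetric] dest: less_imp_le)
  ultimately show False using fin finite_subset by blast
qed

section \<open>From guessing clubs to guessing cofinal sets\<close>

lemma boxtimes_minus_of_guessing:
  assumes C: "coherent_ladder C"
    and guess: "\<And>E. club r E \<Longrightarrow> \<exists>\<alpha>\<in>S. lpt (nacc r (C \<alpha>) \<inter> E) \<alpha>"
    and "small_exp r" "S \<in> J_omega r"
  shows "boxtimes_minus r S"
proof (rule ccontr)
  assume no: "\<not> boxtimes_minus r S"
  obtain Cl F where Cl: "club r Cl" and F: "\<forall>i\<in>K. \<forall>\<beta>\<in>K. finite (F i \<beta>)"
    and J: "\<forall>\<alpha>\<in>S \<inter> Cl. \<forall>f B. (\<forall>\<beta>. \<beta> \<prec> \<alpha> \<longrightarrow> f \<beta> \<prec> \<alpha> \<and> (onz r \<beta> \<longrightarrow> f \<beta> \<prec> \<beta>)) \<and>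
        B \<subseteq> underS r \<alpha> \<and> lpt B \<alpha> \<longrightarrow> (\<exists>i. i \<prec> \<alpha> \<and> lpt {\<beta> \<in> B. f \<beta> \<in> F i \<beta>} \<alpha>)"
    using J_omegaD[OF assms(4)] by (elim exE conjE) (rule that)
  \<comment> \<open>\<open>small_exp\<close> lets an ordinal code a whole function from the
    predecessors of \<open>a\<close> into \<open>K\<close>; \<open>e a\<close> is such a
    coding.\<close>
  have "\<exists>e. inj_on e (Func (underS r a) K) \<and> e ` Func (underS r a) K \<subseteq> K" if "a \<in> K" for a
  proof -
    have "|Func (underS r a) K| \<le>o |K|"
      using assms(3) that card_of_Field_ordIso[OF card] unfolding small_exp_def
      by (meson ordIso_symmetric ordLeq_ordIso_trans)
    then show ?thesis by (simp add: card_of_ordLeq)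
  qed
  then obtain e where e: "\<And>a. a \<in> K \<Longrightarrow> inj_on (e a) (Func (underS r a) K)"
    "\<And>a. a \<in> K \<Longrightarrow> e a ` Func (underS r a) K \<subseteq> K" by metis
  \<comment> \<open>Each \<eta> in \<open>F i b\<close> is decoded as a function on the predecessors
    of \<open>a\<close> and evaluated at \<open>i\<close>. Junk values, for \<eta> that is no code
    or \<open>i\<close> not below \<open>a\<close>, are harmless: the set stays finite, and filling
    keeps only points inside the gap.\<close>
  define G where "G i a b = (\<lambda>\<eta>. inv_into (Func (underS r a) K) (e a) \<eta> i) ` F i b" for i a b
  have "coherent_ladder (\<lambda>\<alpha>. fill_gaps (G i) (C \<alpha>))" if "i \<in> K" for i
    using C by (rule coherent_ladder_fill_gaps) (use F that lt_Field in \<open>auto simp: G_def\<close>)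
  then have "\<forall>i\<in>K. \<exists>A. unbounded r A \<and> (\<forall>\<alpha>\<in>S. \<not> lpt (nacc r (fill_gaps (G i) (C \<alpha>)) \<inter> A) \<alpha>)"
    using no boxtimes_minusI by meson
  then obtain A where A: "\<And>i. i \<in> K \<Longrightarrow> unbounded r (A i)"
    "\<And>i \<alpha>. i \<in> K \<Longrightarrow> \<alpha> \<in> S \<Longrightarrow> \<not> lpt (nacc r (fill_gaps (G i) (C \<alpha>)) \<inter> A i) \<alpha>" by metis
  have "\<exists>x. x \<in> A i \<and> a \<prec> x" if "i \<in> K" "a \<in> K" for i a
    using A(1) that unfolding unbounded_def by blast
  then obtain m where m: "\<And>i a. i \<in> K \<Longrightarrow> a \<in> K \<Longrightarrow> m i a \<in> A i \<and> a \<prec> m i a" by metis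
  \<comment> \<open>One function records a point of \<open>A i\<close> above \<open>a\<close> for
    all \<open>i\<close> below \<open>a\<close> at once; \<open>undefined\<close> elsewhere is what
    \<open>Func\<close> demands.\<close>
  define g where "g a = (\<lambda>i. if i \<prec> a then m i a else undefined)" for a
  have g: "g a \<in> Func (underS r a) K" if "a \<in> K" for a
  proof -
    have "m i a \<in> K" if "i \<prec> a" for i
      using m[of i a] that lt_Field by blast
    then show ?thesis by (auto simp: Func_def g_def)
  qed
  have "\<exists>c. c \<in> K \<and> e a (g a) \<prec> c \<and> (\<forall>i. i \<prec> a \<longrightarrow> m i a \<prec> c)" if a: "a \<in> K" for a
  proof -
    obtain c0 where c0: "c0 \<in> K" "\<And>i. i \<prec> a \<Longrightarrow> m i a \<prec> c0"
      using ex_bound_underS[OF a, of "\<lambda>i. m i a"] m a lt_Field by metis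
    have "e a (g a) \<in> K" using e(2) g a by blast
    then obtain c where "c0 \<prec> c" "e a (g a) \<prec> c" using ex_greater c0(1) by metis
    then show ?thesis using c0(2) lt_trans lt_Field by blast
  qed
  then obtain h where h: "\<And>a. a \<in> K \<Longrightarrow> h a \<in> K" "\<And>a. a \<in> K \<Longrightarrow> e a (g a) \<prec> h a"
    "\<And>a i. a \<in> K \<Longrightarrow> i \<prec> a \<Longrightarrow> m i a \<prec> h a" by metis
  \<comment> \<open>At \<beta> in \<open>E\<close> and \<open>a\<close> below \<beta>, the code of
    \<open>g a\<close> and all points \<open>m i a\<close> with \<open>i\<close> below
    \<open>a\<close> lie below \<beta>. Thus coding is regressive and the chosen points fit into a
    gap ending at \<beta>.\<close>
  define E where "E = {\<beta>. closed_under h \<beta>} \<inter> Cl"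
  have "club r E"
    unfolding E_def using h(1) by (intro club_Int club_closed_under Cl)
  then obtain \<alpha> where \<alpha>: "\<alpha> \<in> S" "lpt (nacc r (C \<alpha>) \<inter> E) \<alpha>" using guess by blast
  then have lim: "lpt K \<alpha>" using lpt_K by blast
  have "lpt Cl \<alpha>" using \<alpha>(2) by (rule lpt_mono) (simp add: E_def)
  then have "\<alpha> \<in> Cl" using Cl unfolding club_iff by blast
  have ladder: "C \<alpha> \<subseteq> underS r \<alpha>" "lpt (C \<alpha>) \<alpha>"
    "\<And>\<gamma>. \<gamma> \<prec> \<alpha> \<Longrightarrow> lpt (C \<alpha>) \<gamma> \<Longrightarrow> \<gamma> \<in> C \<alpha>"
    using C lim by (auto simp: coherent_ladder_def)
  \<comment> \<open>Only the least element of \<open>C \<alpha>\<close> is discarded, as no gap ends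
    there. Any other non-accumulation point has an immediate predecessor \<open>p \<beta>\<close> in
    \<open>C \<alpha>\<close>.\<close>
  define B where "B = {\<beta> \<in> nacc r (C \<alpha>) \<inter> E. \<exists>c\<in>C \<alpha>. c \<prec> \<beta>}"
  have B_below: "\<beta> \<prec> \<alpha>" if "\<beta> \<in> B" for \<beta>
    using that ladder(1) by (auto simp: B_def nacc_iff)
  have "\<exists>p. consecutive (C \<alpha>) p \<beta>" if \<beta>: "\<beta> \<in> B" for \<beta>
  proof -
    from \<beta> obtain c where c: "\<beta> \<in> C \<alpha>" "\<not> lpt (C \<alpha>) \<beta>" "c \<in> C \<alpha>" "c \<prec> \<beta>"
      by (auto simp: B_def nacc_iff)
    have "\<gamma> \<in> C \<alpha>" if "\<gamma> \<prec> \<beta>" "lpt (C \<alpha>) \<gamma>" for \<gamma>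
      using that ladder(3) lt_trans B_below[OF \<beta>] by blast
    then obtain p where "p \<in> C \<alpha>" "p \<prec> \<beta>" "\<And>y. y \<in> C \<alpha> \<Longrightarrow> y \<prec> \<beta> \<Longrightarrow> \<not> p \<prec> y"
      using ex_max_below[of \<beta> "C \<alpha>" c] c by blast
    then show ?thesis using c(1) unfolding consecutive_def by blast
  qed
  then obtain p where p: "\<And>\<beta>. \<beta> \<in> B \<Longrightarrow> consecutive (C \<alpha>) (p \<beta>) \<beta>" by metis
  then have p': "p \<beta> \<prec> \<beta>" "p \<beta> \<in> K" if "\<beta> \<in> B" for \<beta>
    using that lt_Field unfolding consecutive_def by blast+
  have B_closed: "h a \<prec> \<beta>" if "\<beta> \<in> B" "a \<prec> \<beta>" for \<beta> a
    using that by (auto simp: B_def E_def closed_under_def)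
  \<comment> \<open>On \<open>B\<close> the value codes the points chosen above
    \<open>p \<beta>\<close>; elsewhere any regressive value serves, since capture is only sought on
    \<open>B\<close>.\<close>
  define f where
    "f \<beta> = (if \<beta> \<in> B then e (p \<beta>) (g (p \<beta>)) else SOME y. y \<prec> \<alpha> \<and> (onz r \<beta> \<longrightarrow> y \<prec> \<beta>))" for \<beta>
  have "f \<beta> \<prec> \<alpha> \<and> (onz r \<beta> \<longrightarrow> f \<beta> \<prec> \<beta>)" if "\<beta> \<prec> \<alpha>" for \<beta>
  proof (cases "\<beta> \<in> B")
    case True
    then have "f \<beta> \<prec> \<beta>"
      using h(2)[OF p'(2)] B_closed[OF True p'(1)] lt_trans by (auto simp: f_def)
    with that lt_trans show ?thesis by blast
  next
    case False
    have "\<exists>y. y \<prec> \<alpha> \<and> (onz r \<beta> \<longrightarrow> y \<prec> \<beta>)"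
      using that lt_trans unfolding onz_def by blast
    from someI_ex[OF this] False show ?thesis by (simp add: f_def)
  qed
  moreover have "lpt B \<alpha>"
    unfolding lpt_def
  proof (intro conjI allI impI)
    fix d assume "d \<prec> \<alpha>"
    with ladder(2) obtain c where c: "c \<in> C \<alpha>" "d \<prec> c" "c \<prec> \<alpha>" by (rule lptE)
    with \<alpha>(2) obtain \<beta> where "\<beta> \<in> nacc r (C \<alpha>) \<inter> E" "c \<prec> \<beta>" "\<beta> \<prec> \<alpha>" by (auto elim: lptE)
    with c lt_trans show "\<exists>x\<in>B. d \<prec> x \<and> x \<prec> \<alpha>" unfolding B_def by blast
  qed (rule lpt_onz[OF lim])
  moreover have "B \<subseteq> underS r \<alpha>" using B_below by auto
  ultimately obtain i where i: "i \<prec> \<alpha>" "lpt {\<beta> \<in> B. f \<beta> \<in> F i \<beta>} \<alpha>"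
    using J[rule_format, of \<alpha> f B] \<alpha>(1) \<open>\<alpha> \<in> Cl\<close> by blast
  have "i \<in> K" using i(1) lt_Field by blast
  have "lpt (nacc r (fill_gaps (G i) (C \<alpha>)) \<inter> A i) \<alpha>"
    unfolding lpt_def
  proof (intro conjI allI impI)
    fix d assume "d \<prec> \<alpha>"
    \<comment> \<open>Taking \<open>c\<close> in \<open>C \<alpha>\<close> above both
      \<open>d\<close> and \<open>i\<close> puts \<open>p \<beta>\<close> above them for every
      \<beta> beyond \<open>c\<close>, so that \<open>i\<close> indexes a genuine entry of
      \<open>g (p \<beta>)\<close>.\<close>
    then obtain c where c: "c \<in> C \<alpha>" "d \<prec> c" "i \<prec> c" "c \<prec> \<alpha>"
      using lptE2[OF ladder(2) _ i(1)] by blast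
    with i(2) obtain \<beta> where \<beta>: "\<beta> \<in> B" "f \<beta> \<in> F i \<beta>" "c \<prec> \<beta>" "\<beta> \<prec> \<alpha>" by (auto elim: lptE)
    have "\<not> p \<beta> \<prec> c"
      using p[OF \<beta>(1)] c(1) \<beta>(3) unfolding consecutive_def by blast
    then have above: "d \<prec> p \<beta>" "i \<prec> p \<beta>"
      using c(2,3) p'(2)[OF \<beta>(1)] lt_le_trans by blast+
    define \<xi> where "\<xi> = m i (p \<beta>)"
    have \<xi>: "p \<beta> \<prec> \<xi>" "\<xi> \<in> A i"
      using m \<open>i \<in> K\<close> p'(2)[OF \<beta>(1)] by (auto simp: \<xi>_def)
    have "\<xi> \<prec> \<beta>"
      unfolding \<xi>_def using h(3)[OF p'(2)[OF \<beta>(1)] above(2)] B_closed[OF \<beta>(1) p'(1)[OF \<beta>(1)]]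
      by (rule lt_trans)
    have "inv_into (Func (underS r (p \<beta>)) K) (e (p \<beta>)) (f \<beta>) = g (p \<beta>)"
      using \<beta>(1) e(1)[OF p'(2)[OF \<beta>(1)]] g[OF p'(2)[OF \<beta>(1)]] by (simp add: f_def)
    then have "\<xi> \<in> G i (p \<beta>) \<beta>"
      unfolding G_def using \<beta>(2) above(2) by (force simp: g_def \<xi>_def)
    then have "\<xi> \<in> fill_gaps (G i) (C \<alpha>)"
      using p[OF \<beta>(1)] \<xi>(1) \<open>\<xi> \<prec> \<beta>\<close> unfolding fill_gaps_def by blast
    \<comment> \<open>Limits of the filled set are limits of \<open>C \<alpha>\<close>, and none of
      those lies inside a gap; hence the inserted point is a non-accumulation point.\<close>
    moreover have "\<not> lpt (fill_gaps (G i) (C \<alpha>)) \<xi>"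
    proof
      assume "lpt (fill_gaps (G i) (C \<alpha>)) \<xi>"
      then have "lpt (C \<alpha>) \<xi>"
        by (rule lpt_fill_gaps) (use F \<open>i \<in> K\<close> consecutive_Field in \<open>auto simp: G_def\<close>)
      then show False using lpt_not_in_gap p[OF \<beta>(1)] \<xi>(1) \<open>\<xi> \<prec> \<beta>\<close> by blast
    qed
    moreover have "d \<prec> \<xi>" "\<xi> \<prec> \<alpha>"
      using above(1) \<xi>(1) \<open>\<xi> \<prec> \<beta>\<close> \<beta>(4) lt_trans by blast+
    ultimately show "\<exists>x\<in>nacc r (fill_gaps (G i) (C \<alpha>)) \<inter> A i. d \<prec> x \<and> x \<prec> \<alpha>"
      using \<xi>(2) by (auto simp: nacc_iff)
  qed (rule lpt_onz[OF lim])
  with A(2) \<alpha>(1) \<open>i \<in> K\<close> show False by blast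
qed

end

theorem theorem4p1:
  fixes r :: "'a rel" and S :: "'a set"
  assumes "Card_order r" and "regularCard r" and "uncountable_set (Field r)"
    and "square r" and "small_exp r"
    and "stationary r S" and "S \<in> J_omega r"
  shows "boxtimes_minus r S"
proof -
  interpret regular_uncountable r
    using assms(1-3) by (rule regular_uncountable.intro)
  obtain \<theta> where \<theta>: "\<theta> \<in> Field r" "uncountable (underS r \<theta>)"
    by (rule J_omega_uncountable_segment[OF assms(6,7)])
  obtain C where C: "coherent_ladder C"
    and guess: "\<forall>E. club r E \<longrightarrow> (\<exists>\<alpha>\<in>S. lpt (nacc r (C \<alpha>) \<inter> E) \<alpha>)"
    using ex_guessing_ladder[OF assms(4,6) \<theta>] by (elim exE conjE) (rule that)
  show ?thesis
    using C guess[rule_format] assms(5,7) by (rule boxtimes_minus_of_guessing)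
qed

end
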